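(* Let $\Gamma_t$ and $\Sigma_t$ be mean curvature flows of hypersurfaces in $\mathbb R^{n+1}$ with each $\Sigma_t$ proper and $\Gamma_t\cap\Sigma_t=\emptyset$, and let $d(x,t)=\inf_{y\in\Sigma_t}|x-y|$. Let $c_1,c_2\in\mathbb R$, $x_0\in\mathbb R^{n+1}$, and $f(x,t)=c_1+c_2(|x-x_0|^2+2nt)$. Then $\Box_{\Gamma_t}(e^f d^{-1})\le 0$ in the viscosity sense: for every $(y_0,t_0)$ with $y_0\in\Gamma_{t_0}$ and every $C^2$ function $\phi$ on the space-time track near $(y_0,t_0)$ with $\phi\ge e^fd^{-1}$ for $t\le t_0$ near $(y_0,t_0)$ and equality at $(y_0,t_0)$, one has $\Box_{\Gamma_t}\phi(y_0,t_0)\le 0$.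
   Context: A hypersurface immersion is proper if its intersection with every compact set is compact. Sign conventions: the mean curvature is the sum of the principal curvatures, taken so that the round sphere $\partial B_r(c)$ with unit normal $(x-c)/r$ has all principal curvatures $-1/r$. A mean curvature flow is a smooth family of immersed hypersurfaces $\Gamma_t$ with unit normal $\mathbf n_{\Gamma_t}$ and mean curvature $H_{\Gamma_t}$ whose points move by $\partial_t x=H_{\Gamma_t}\mathbf n_{\Gamma_t}$. $\Box_{\Gamma_t}u=\partial_t u-\Delta_{\Gamma_t}u$, with $\partial_t$ the derivative along normal trajectories $x'(t)=H_{\Gamma_t}\mathbf n_{\Gamma_t}$ and $\Delta_{\Gamma_t}$ the Laplace–Beltrami operator of $\Gamma_t$. *)

theory Defs
  imports "HOL-Analysis.Analysis"
begin

definition dirD :: "'a::real_normed_vector \<Rightarrow> ('a \<Rightarrow> 'b::real_normed_vector) \<Rightarrow> 'a \<Rightarrow> 'b" where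
  "dirD b f x = vector_derivative (\<lambda>s. f (x + s *\<^sub>R b)) (at 0)"

fun Ck :: "nat \<Rightarrow> 'a::euclidean_space set \<Rightarrow> ('a \<Rightarrow> 'b::real_normed_vector) \<Rightarrow> bool" where
  "Ck 0 S f = continuous_on S f"
| "Ck (Suc k) S f = (continuous_on S f \<and> (\<forall>x\<in>S. f differentiable (at x))
       \<and> (\<forall>b\<in>Basis. Ck k S (dirD b f)))"

definition smooth_on :: "'a::euclidean_space set \<Rightarrow> ('a \<Rightarrow> 'b::real_normed_vector) \<Rightarrow> bool" where
  "smooth_on S f \<longleftrightarrow> (\<forall>k. Ck k S f)"

definition smooth_atlas :: "((real^'n) set \<times> (real^'n \<Rightarrow> 'm::topological_space)) set \<Rightarrow> bool" where
  "smooth_atlas A \<longleftrightarrow>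
     (\<Union>(U,\<psi>)\<in>A. \<psi> ` U) = UNIV \<and>
     (\<forall>(U,\<psi>)\<in>A. open U \<and> open (\<psi> ` U) \<and> (\<exists>\<phi>. homeomorphism U (\<psi> ` U) \<psi> \<phi>)) \<and>
     (\<forall>(U,\<psi>)\<in>A. \<forall>(V,\<rho>)\<in>A. smooth_on {u\<in>U. \<psi> u \<in> \<rho> ` V} (\<lambda>u. inv_into V \<rho> (\<psi> u)))"

text \<open>X : (u,t) \<mapsto> position, u in the chart domain, t time.\<close>

definition Du :: "'n \<Rightarrow> ((real^'n) \<times> real \<Rightarrow> 'b::real_normed_vector) \<Rightarrow> (real^'n) \<times> real \<Rightarrow> 'b" where
  "Du i g p = dirD (axis i 1, 0) g p"

definition Dt :: "((real^'n::finite) \<times> real \<Rightarrow> 'b::real_normed_vector) \<Rightarrow> (real^'n) \<times> real \<Rightarrow> 'b" where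
  "Dt g p = dirD (0, 1) g p"

definition gmat :: "((real^'n::finite) \<times> real \<Rightarrow> real^'N::finite) \<Rightarrow> (real^'n) \<times> real \<Rightarrow> real^'n^'n" where
  "gmat X p = (\<chi> i j. Du i X p \<bullet> Du j X p)"

definition ginv :: "((real^'n::finite) \<times> real \<Rightarrow> real^'N::finite) \<Rightarrow> (real^'n) \<times> real \<Rightarrow> real^'n^'n" where
  "ginv X p = matrix_inv (gmat X p)"

text \<open>Mean curvature (sum of principal curvatures) w.r.t. the unit normal \<nu>;
  h_ij = (d_i d_j X) . \<nu>, so the sphere with outer normal has curvatures -1/r.\<close>
definition mean_curv :: "((real^'n::finite) \<times> real \<Rightarrow> real^'N::finite) \<Rightarrow> ((real^'n) \<times> real \<Rightarrow> real^'N)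
      \<Rightarrow> (real^'n) \<times> real \<Rightarrow> real" where
  "mean_curv X \<nu> p = (\<Sum>i\<in>UNIV. \<Sum>j\<in>UNIV. ginv X p $ i $ j * (Du i (Du j X) p \<bullet> \<nu> p))"

definition christoffel :: "((real^'n::finite) \<times> real \<Rightarrow> real^'N::finite) \<Rightarrow> 'n \<Rightarrow> 'n \<Rightarrow> 'n
      \<Rightarrow> (real^'n) \<times> real \<Rightarrow> real" where
  "christoffel X k i j p = (\<Sum>l\<in>UNIV. ginv X p $ k $ l * (Du i (Du j X) p \<bullet> Du l X p))"

definition laplace_beltrami :: "((real^'n::finite) \<times> real \<Rightarrow> real^'N::finite) \<Rightarrow> ((real^'n) \<times> real \<Rightarrow> real)
      \<Rightarrow> (real^'n) \<times> real \<Rightarrow> real" where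
  "laplace_beltrami X u p = (\<Sum>i\<in>UNIV. \<Sum>j\<in>UNIV. ginv X p $ i $ j *
       (Du i (Du j u) p - (\<Sum>k\<in>UNIV. christoffel X k i j p * Du k u p)))"

text \<open>Heat operator Box u = d_t u - Delta u; in a normal parametrisation
  (d_t X = H \<nu>) the time derivative at fixed u is along normal trajectories.\<close>
definition heat_op :: "((real^'n::finite) \<times> real \<Rightarrow> real^'N::finite) \<Rightarrow> ((real^'n) \<times> real \<Rightarrow> real)
      \<Rightarrow> (real^'n) \<times> real \<Rightarrow> real" where
  "heat_op X u p = Dt u p - laplace_beltrami X u p"

text \<open>F p t is the position at time t of the point p of the parameter manifold;
  N p t is the chosen unit normal.\<close>
definition mcf :: "((real^'n::finite) set \<times> (real^'n \<Rightarrow> 'm::topological_space)) set \<Rightarrow> real set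
      \<Rightarrow> ('m \<Rightarrow> real \<Rightarrow> real^'N::finite) \<Rightarrow> ('m \<Rightarrow> real \<Rightarrow> real^'N) \<Rightarrow> bool" where
  "mcf A I F N \<longleftrightarrow> smooth_atlas A \<and> open I \<and> is_interval I \<and>
     (\<forall>(U,\<psi>)\<in>A.
        smooth_on (U \<times> I) (\<lambda>(u,t). F (\<psi> u) t) \<and>
        smooth_on (U \<times> I) (\<lambda>(u,t). N (\<psi> u) t) \<and>
        (\<forall>u\<in>U. \<forall>t\<in>I.
           norm (N (\<psi> u) t) = 1 \<and>
           (\<forall>i. N (\<psi> u) t \<bullet> Du i (\<lambda>(u,t). F (\<psi> u) t) (u,t) = 0) \<and>
           (\<forall>v::real^'n. (\<Sum>i\<in>UNIV. v $ i *\<^sub>R Du i (\<lambda>(u,t). F (\<psi> u) t) (u,t)) = 0 \<longrightarrow> v = 0) \<and>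
           Dt (\<lambda>(u,t). F (\<psi> u) t) (u,t) =
             mean_curv (\<lambda>(u,t). F (\<psi> u) t) (\<lambda>(u,t). N (\<psi> u) t) (u,t) *\<^sub>R N (\<psi> u) t))"

definition proper_fun :: "('m::topological_space \<Rightarrow> 'b::topological_space) \<Rightarrow> bool" where
  "proper_fun g \<longleftrightarrow> (\<forall>K. compact K \<longrightarrow> compact (g -` K))"

end

theory Submission
  imports Defs
begin

text \<open>
  Let \<open>y0 = Y(v0,t0)\<close> be a point of \<open>\<Sigma>_t0\<close> closest to \<open>x = X(u0,t0)\<close>; it exists because
  \<open>\<Sigma>_t0\<close> is the image of a proper continuous map, hence closed. Since
  \<open>d(X(u,t),t) \<le> |X(u,t) - Y(v,t)|\<close>, the test function also lies above the doubled barrier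
  \<open>exp f(X(u,t),t) / |X(u,t) - Y(v,t)|\<close>, a smooth function of \<open>(u,v,t)\<close> which it touches at
  \<open>(u0,v0,t0)\<close>. First-order contact in \<open>v\<close> alone shows that the gap \<open>x - y0\<close> is normal to \<open>\<Sigma>_t0\<close>.

  Take an orthonormal frame \<open>\<tau>_k\<close> of the tangent space of \<open>\<Gamma>_t0\<close> and reflect it in the
  hyperplane that swaps the unit normal of \<open>\<Gamma>_t0\<close> (oriented against the gap) with the unit gap
  direction: this gives an orthonormal frame \<open>\<sigma>_k\<close> of the tangent space of \<open>\<Sigma>_t0\<close> with
  \<open>|\<tau>_k - \<sigma>_k|\<^sup>2 \<le> 2 ((x - y0) \<bullet> \<tau>_k)\<^sup>2 / |x - y0|\<^sup>2\<close>, which is exactly what is needed to drop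
  the cross terms of the second-order contact condition along the paired directions
  \<open>(\<tau>_k, \<sigma>_k)\<close>. Summing over \<open>k\<close> bounds the Laplace-Beltrami operator of the test function from
  below, contact from the past bounds its time derivative from above, and the two bounds agree
  because both surfaces move by their mean curvature vectors; the term \<open>2n t\<close> in \<open>f\<close> pays for
  the \<open>n\<close> terms \<open>2 c2 |\<tau>_k|\<^sup>2\<close>.
\<close>

section \<open>Frames of a tangent hyperplane\<close>

definition lin_indep_family :: "('n::finite \<Rightarrow> 'a::real_vector) \<Rightarrow> bool" where
  "lin_indep_family X \<longleftrightarrow> (\<forall>v::real^'n. (\<Sum>i\<in>UNIV. v $ i *\<^sub>R X i) = 0 \<longrightarrow> v = 0)"

lemma gram_inverse_left:
  fixes X :: "'n::finite \<Rightarrow> 'a::real_inner"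
  assumes "lin_indep_family X"
  shows "matrix_inv (\<chi> i j. X i \<bullet> X j) ** (\<chi> i j. X i \<bullet> X j) = mat 1"
proof -
  define g where "g = (\<chi> i j. X i \<bullet> X j)"
  have "x = 0" if gx: "g *v x = 0" for x
  proof -
    have "(\<Sum>i\<in>UNIV. x $ i *\<^sub>R X i) \<bullet> (\<Sum>j\<in>UNIV. x $ j *\<^sub>R X j) = (\<Sum>i\<in>UNIV. x $ i * (g *v x) $ i)"
      by (simp add: inner_sum_left inner_sum_right g_def matrix_vector_mult_def sum_distrib_left
          inner_commute mult_ac)
    with gx have "(\<Sum>i\<in>UNIV. x $ i *\<^sub>R X i) = 0" by simp
    with assms show "x = 0" unfolding lin_indep_family_def by blast
  qed
  then have "invertible g"
    using matrix_left_invertible_ker invertible_left_inverse by blast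
  then have "g ** matrix_inv g = mat 1 \<and> matrix_inv g ** g = mat 1"
    unfolding invertible_def matrix_inv_def by (rule someI_ex)
  then show ?thesis unfolding g_def by simp
qed

lemma gram_inverse_mult_inner:
  fixes X :: "'n::finite \<Rightarrow> 'a::real_inner"
  assumes "lin_indep_family X"
  shows "(\<Sum>m\<in>UNIV. matrix_inv (\<chi> i j. X i \<bullet> X j) $ l $ m * (X m \<bullet> X i)) = (if l = i then 1 else 0)"
  using arg_cong[OF gram_inverse_left[OF assms], of "\<lambda>M. M $ l $ i"]
  by (simp add: matrix_matrix_mult_def mat_def)

lemma lin_indep_family_inj:
  assumes "lin_indep_family X"
  shows "inj X"
proof (rule injI, rule ccontr)
  fix i j assume eq: "X i = X j" and ne: "i \<noteq> j"
  define v :: "real^'a" where "v = axis i 1 - axis j 1"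
  have "(\<Sum>k\<in>UNIV. v $ k *\<^sub>R X k) = X i - X j"
    using ne by (simp add: v_def axis_def scaleR_diff_left sum_subtractf
        if_distrib[where f="\<lambda>x. x *\<^sub>R _"] cong: if_cong)
  with assms eq have "v = 0" unfolding lin_indep_family_def by simp
  then have "v $ i = 0" by simp
  then show False using ne by (simp add: v_def axis_def)
qed

lemma tangent_normal_span:
  fixes X :: "'n::finite \<Rightarrow> real^'N::finite" and \<nu> :: "real^'N"
  assumes indep: "lin_indep_family X" and orth: "\<forall>i. \<nu> \<bullet> X i = 0" and unit: "norm \<nu> = 1"
    and dim: "CARD('N) = CARD('n) + 1"
  obtains a b where "Z = (\<Sum>i\<in>UNIV. a i *\<^sub>R X i) + b *\<^sub>R \<nu>"
proof -
  have injX: "inj X" using indep by (rule lin_indep_family_inj)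
  have nuX: "\<nu> \<notin> range X"
  proof
    assume "\<nu> \<in> range X"
    then obtain i where "\<nu> = X i" by blast
    then have "\<nu> \<bullet> \<nu> = 0" using orth by simp
    then show False using unit by (simp add: norm_eq_sqrt_inner)
  qed
  define B where "B = insert \<nu> (range X)"
  have finB: "finite B" unfolding B_def by simp
  have sum_B: "(\<Sum>v\<in>B. c v *\<^sub>R v) = (\<Sum>i\<in>UNIV. c (X i) *\<^sub>R X i) + c \<nu> *\<^sub>R \<nu>" for c
    unfolding B_def using nuX injX by (simp add: sum.reindex)
  have "independent B"
    unfolding independent_explicit
  proof (intro conjI finB allI impI ballI)
    fix c v assume "(\<Sum>v\<in>B. c v *\<^sub>R v) = 0" and vB: "v \<in> B"
    then have eq0: "(\<Sum>i\<in>UNIV. c (X i) *\<^sub>R X i) + c \<nu> *\<^sub>R \<nu> = 0" by (simp add: sum_B)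
    have "\<nu> \<bullet> ((\<Sum>i\<in>UNIV. c (X i) *\<^sub>R X i) + c \<nu> *\<^sub>R \<nu>) = c \<nu>"
      using orth unit by (simp add: inner_add_right inner_sum_right norm_eq_sqrt_inner)
    then have c0: "c \<nu> = 0" using eq0 by simp
    then have "(\<Sum>i\<in>UNIV. (\<chi> k. c (X k)) $ i *\<^sub>R X i) = 0" using eq0 by simp
    then have "(\<chi> k. c (X k)) = 0" using indep unfolding lin_indep_family_def by blast
    then have "\<forall>k. c (X k) = 0" by (metis vec_lambda_beta zero_index)
    then show "c v = 0" using vB c0 unfolding B_def by auto
  qed
  moreover have "card B = CARD('n) + 1"
    unfolding B_def using nuX injX by (simp add: card_image)
  ultimately have "UNIV \<subseteq> span B"
    using dim by (intro card_ge_dim_independent) auto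
  then obtain u where "Z = (\<Sum>v\<in>B. u v *\<^sub>R v)" using span_finite[OF finB] by auto
  then show ?thesis using that[of "\<lambda>i. u (X i)" "u \<nu>"] by (simp add: sum_B)
qed

lemma tangent_normal_decomposition:
  fixes X :: "'n::finite \<Rightarrow> real^'N::finite" and \<nu> :: "real^'N"
  assumes indep: "lin_indep_family X" and orth: "\<forall>i. \<nu> \<bullet> X i = 0" and unit: "norm \<nu> = 1"
    and dim: "CARD('N) = CARD('n) + 1"
  shows "Z = (\<Sum>l\<in>UNIV. (\<Sum>m\<in>UNIV. matrix_inv (\<chi> i j. X i \<bullet> X j) $ l $ m * (Z \<bullet> X m)) *\<^sub>R X l)
             + (Z \<bullet> \<nu>) *\<^sub>R \<nu>"
proof -
  define gi where "gi = matrix_inv (\<chi> i j. X i \<bullet> X j)"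
  obtain a b where Z: "Z = (\<Sum>i\<in>UNIV. a i *\<^sub>R X i) + b *\<^sub>R \<nu>"
    using tangent_normal_span[OF indep orth unit dim] by blast
  have orth': "X i \<bullet> \<nu> = 0" for i using orth by (simp add: inner_commute)
  have Z_nu: "Z \<bullet> \<nu> = b"
    using orth' unit by (simp add: Z inner_add_left inner_sum_left norm_eq_sqrt_inner)
  have Z_X: "Z \<bullet> X m = (\<Sum>i\<in>UNIV. a i * (X i \<bullet> X m))" for m
    using orth by (simp add: Z inner_add_left inner_sum_left)
  have "(\<Sum>m\<in>UNIV. gi $ l $ m * (Z \<bullet> X m)) = a l" for l
  proof -
    have "(\<Sum>m\<in>UNIV. gi $ l $ m * (Z \<bullet> X m))
        = (\<Sum>i\<in>UNIV. a i * (\<Sum>m\<in>UNIV. gi $ l $ m * (X m \<bullet> X i)))"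
      by (simp add: Z_X sum_distrib_left sum_distrib_right mult_ac, subst sum.swap,
          simp add: inner_commute)
    also have "\<dots> = (\<Sum>i\<in>UNIV. a i * (if l = i then 1 else 0))"
      using gram_inverse_mult_inner[OF indep] unfolding gi_def by simp
    also have "\<dots> = a l" by (simp add: if_distrib cong: if_cong)
    finally show ?thesis .
  qed
  then show ?thesis unfolding gi_def[symmetric] using Z Z_nu by simp
qed

lemma hyperplane_orthonormal_frame:
  fixes \<nu> :: "real^'N::finite"
  assumes unit: "norm \<nu> = 1" and dim: "CARD('N) = CARD('n) + 1"
  obtains \<tau> :: "'n::finite \<Rightarrow> real^'N" where "\<And>k. norm (\<tau> k) = 1" "\<And>k. \<tau> k \<bullet> \<nu> = 0"
    "\<And>Z. Z \<bullet> \<nu> = 0 \<Longrightarrow> Z = (\<Sum>k\<in>UNIV. (Z \<bullet> \<tau> k) *\<^sub>R \<tau> k)"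
proof -
  define S where "S = {x. \<nu> \<bullet> x = 0}"
  have subS: "subspace S" unfolding S_def by (rule subspace_hyperplane)
  have "\<nu> \<noteq> 0" using unit by auto
  then have "dim S = DIM(real^'N) - 1" unfolding S_def by (rule dim_hyperplane)
  then have dimS: "dim S = CARD('n)" using dim by simp
  obtain B where BS: "B \<subseteq> S" and orthB: "pairwise orthogonal B" and unitB: "\<And>x. x \<in> B \<Longrightarrow> norm x = 1"
    and indB: "independent B" and cardB: "card B = dim S" and spanB: "span B = S"
    using orthonormal_basis_subspace[OF subS] by blast
  have finB: "finite B" using indB by (rule independent_imp_finite)
  have "card (UNIV::'n set) = card B" using cardB dimS by simp
  then obtain h where h: "bij_betw h (UNIV::'n set) B"
    using finite_same_card_bij[OF finite_class.finite_UNIV finB] by blast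
  show ?thesis
  proof (rule that[of h])
    fix k
    have hk: "h k \<in> B" using h bij_betwE by blast
    then show "norm (h k) = 1" by (rule unitB)
    have "\<nu> \<bullet> h k = 0" using BS hk unfolding S_def by blast
    then show "h k \<bullet> \<nu> = 0" by (simp only: inner_commute)
  next
    fix Z assume "Z \<bullet> \<nu> = 0"
    then have "Z \<in> span B" unfolding spanB S_def by (simp only: inner_commute mem_Collect_eq)
    then have "Z = (\<Sum>b\<in>B. (Z \<bullet> b) *\<^sub>R b)"
      using orthonormal_basis_expand[OF orthB unitB _ finB, of Z] by (simp only:)
    also have "\<dots> = (\<Sum>k\<in>UNIV. (Z \<bullet> h k) *\<^sub>R h k)"
      using sum.reindex_bij_betw[OF h, of "\<lambda>b. (Z \<bullet> b) *\<^sub>R b"] by simp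
    finally show "Z = (\<Sum>k\<in>UNIV. (Z \<bullet> h k) *\<^sub>R h k)" .
  qed
qed

lemma orthonormal_frame_coordinates:
  fixes X :: "'n::finite \<Rightarrow> real^'N::finite" and \<nu> :: "real^'N" and \<tau> :: "'n \<Rightarrow> real^'N"
  assumes indep: "lin_indep_family X"
    and orth: "\<forall>i. \<nu> \<bullet> X i = 0" and unit: "norm \<nu> = 1"
    and dim: "CARD('N) = CARD('n) + 1"
    and tangent: "\<And>k. \<tau> k \<bullet> \<nu> = 0"
    and expand: "\<And>Z. Z \<bullet> \<nu> = 0 \<Longrightarrow> Z = (\<Sum>k\<in>UNIV. (Z \<bullet> \<tau> k) *\<^sub>R \<tau> k)"
  defines "gi \<equiv> matrix_inv (\<chi> i j. X i \<bullet> X j)"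
  defines "P \<equiv> (\<lambda>i k. \<Sum>m\<in>UNIV. gi $ i $ m * (X m \<bullet> \<tau> k))"
  shows "\<And>k. \<tau> k = (\<Sum>i\<in>UNIV. P i k *\<^sub>R X i)"
    and "\<And>i j. (\<Sum>k\<in>UNIV. P i k * P j k) = gi $ i $ j"
proof -
  fix k
  have "\<tau> k = (\<Sum>l\<in>UNIV. (\<Sum>m\<in>UNIV. gi $ l $ m * (\<tau> k \<bullet> X m)) *\<^sub>R X l) + (\<tau> k \<bullet> \<nu>) *\<^sub>R \<nu>"
    unfolding gi_def by (rule tangent_normal_decomposition[OF indep orth unit dim])
  then show "\<tau> k = (\<Sum>i\<in>UNIV. P i k *\<^sub>R X i)" using tangent by (simp add: P_def inner_commute)
next
  fix i j
  have Xn: "X m \<bullet> \<nu> = 0" for m using orth by (simp add: inner_commute)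
  have XX: "X m \<bullet> X l = (\<Sum>k\<in>UNIV. (X m \<bullet> \<tau> k) * (X l \<bullet> \<tau> k))" for m l
  proof -
    have "X m \<bullet> X l = (\<Sum>k\<in>UNIV. (X m \<bullet> \<tau> k) *\<^sub>R \<tau> k) \<bullet> X l" using expand[OF Xn[of m]] by simp
    also have "\<dots> = (\<Sum>k\<in>UNIV. (X m \<bullet> \<tau> k) * (\<tau> k \<bullet> X l))" by (simp only: inner_sum_left inner_scaleR_left)
    also have "\<dots> = (\<Sum>k\<in>UNIV. (X m \<bullet> \<tau> k) * (X l \<bullet> \<tau> k))" by (simp only: inner_commute[of "\<tau> _" "X l"])
    finally show ?thesis .
  qed
  have ge: "(\<Sum>l\<in>UNIV. gi $ j $ l * (X l \<bullet> X m)) = (if j = m then 1 else 0)" for m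
    unfolding gi_def by (rule gram_inverse_mult_inner[OF indep])
  have "(\<Sum>k\<in>UNIV. P i k * P j k)
      = (\<Sum>k\<in>UNIV. \<Sum>m\<in>UNIV. \<Sum>l\<in>UNIV. gi $ i $ m * gi $ j $ l * ((X m \<bullet> \<tau> k) * (X l \<bullet> \<tau> k)))"
    by (simp add: P_def sum_distrib_left sum_distrib_right mult_ac, rule sum.cong[OF refl], subst sum.swap, simp add: mult_ac)
  also have "\<dots> = (\<Sum>m\<in>UNIV. \<Sum>l\<in>UNIV. \<Sum>k\<in>UNIV. gi $ i $ m * gi $ j $ l * ((X m \<bullet> \<tau> k) * (X l \<bullet> \<tau> k)))"
    by (subst sum.swap, rule sum.cong[OF refl], rule sum.swap)
  also have "\<dots> = (\<Sum>m\<in>UNIV. \<Sum>l\<in>UNIV. gi $ i $ m * gi $ j $ l * (X m \<bullet> X l))"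
    by (simp add: XX sum_distrib_left)
  also have "\<dots> = (\<Sum>m\<in>UNIV. gi $ i $ m * (\<Sum>l\<in>UNIV. gi $ j $ l * (X l \<bullet> X m)))"
    by (simp add: sum_distrib_left mult_ac inner_commute)
  also have "\<dots> = gi $ i $ j" by (simp add: ge if_distrib cong: if_cong)
  finally show "(\<Sum>k\<in>UNIV. P i k * P j k) = gi $ i $ j" .
qed

definition reflect_along :: "'a::real_inner \<Rightarrow> 'a \<Rightarrow> 'a" where
  "reflect_along m x = x - (2 * (x \<bullet> m) / (m \<bullet> m)) *\<^sub>R m"

lemma linear_reflect_along: "linear (reflect_along m)"
  unfolding reflect_along_def
  by (rule linearI) (simp_all add: inner_add_left add_divide_distrib algebra_simps)

lemma reflect_along_inner:
  assumes "m \<noteq> 0"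
  shows "reflect_along m x \<bullet> reflect_along m y = x \<bullet> y"
  using assms unfolding reflect_along_def
  by (simp add: inner_diff_left inner_diff_right inner_commute field_simps)

lemma reflect_along_involution:
  assumes "m \<noteq> 0"
  shows "reflect_along m (reflect_along m x) = x"
proof -
  have "reflect_along m x \<bullet> m = - (x \<bullet> m)"
    using assms unfolding reflect_along_def by (simp add: inner_diff_left field_simps)
  then show ?thesis unfolding reflect_along_def[of m "reflect_along m x"]
    by (simp add: reflect_along_def)
qed

lemma reflect_along_swaps_unit_vectors:
  fixes \<nu> e :: "'a::real_inner"
  assumes "norm \<nu> = 1" "norm e = 1" "\<nu> \<noteq> e"
  shows "reflect_along (\<nu> - e) \<nu> = e"
proof -
  have "\<nu> \<bullet> \<nu> = 1" "e \<bullet> e = 1" using assms(1,2) by (simp_all add: norm_eq_sqrt_inner)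
  then have "2 * (\<nu> \<bullet> (\<nu> - e)) = (\<nu> - e) \<bullet> (\<nu> - e)"
    by (simp add: inner_diff_left inner_diff_right inner_commute)
  moreover have "(\<nu> - e) \<bullet> (\<nu> - e) \<noteq> 0" using assms(3) by simp
  ultimately show ?thesis unfolding reflect_along_def by simp
qed

lemma reflected_orthonormal_frame:
  fixes \<nu> e :: "real^'N::finite" and \<tau> :: "'n::finite \<Rightarrow> real^'N"
  assumes unit: "norm \<nu> = 1" and unit_e: "norm e = 1" and obtuse: "\<nu> \<bullet> e \<le> 0"
    and tangent: "\<And>k. \<tau> k \<bullet> \<nu> = 0"
    and expand: "\<And>Z. Z \<bullet> \<nu> = 0 \<Longrightarrow> Z = (\<Sum>k\<in>UNIV. (Z \<bullet> \<tau> k) *\<^sub>R \<tau> k)"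
  obtains \<sigma> :: "'n \<Rightarrow> real^'N" where "\<And>k. \<sigma> k \<bullet> e = 0"
    "\<And>Z. Z \<bullet> e = 0 \<Longrightarrow> Z = (\<Sum>k\<in>UNIV. (Z \<bullet> \<sigma> k) *\<^sub>R \<sigma> k)"
    "\<And>k. (norm (\<tau> k - \<sigma> k))\<^sup>2 \<le> 2 * (e \<bullet> \<tau> k)\<^sup>2"
proof -
  define m where "m = \<nu> - e"
  define R where "R = reflect_along m"
  have nu_e: "\<nu> \<noteq> e" using unit obtuse by (auto simp: norm_eq_sqrt_inner)
  then have m0: "m \<noteq> 0" unfolding m_def by simp
  have RR: "R x \<bullet> R y = x \<bullet> y" for x y unfolding R_def by (rule reflect_along_inner[OF m0])
  have RRx: "R (R x) = x" for x unfolding R_def by (rule reflect_along_involution[OF m0])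
  have Rnu: "R \<nu> = e" unfolding R_def m_def by (rule reflect_along_swaps_unit_vectors[OF unit unit_e nu_e])
  have Re: "R e = \<nu>" using RRx[of \<nu>] Rnu by simp
  define \<sigma> where "\<sigma> = (\<lambda>k. R (\<tau> k))"
  show ?thesis
  proof (rule that[of \<sigma>])
    show "\<sigma> k \<bullet> e = 0" for k unfolding \<sigma>_def using RR[of "\<tau> k" \<nu>] Rnu tangent by simp
  next
    fix Z assume "Z \<bullet> e = 0"
    then have "R Z \<bullet> \<nu> = 0" using RR[of Z e] Re by simp
    then have "R (R Z) = R (\<Sum>k\<in>UNIV. (R Z \<bullet> \<tau> k) *\<^sub>R \<tau> k)" using expand by metis
    also have "\<dots> = (\<Sum>k\<in>UNIV. (R Z \<bullet> \<tau> k) *\<^sub>R \<sigma> k)"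
      unfolding \<sigma>_def R_def
      by (simp add: linear_sum[OF linear_reflect_along] linear_scale[OF linear_reflect_along] o_def)
    also have "\<dots> = (\<Sum>k\<in>UNIV. (Z \<bullet> \<sigma> k) *\<^sub>R \<sigma> k)"
      unfolding \<sigma>_def using RR RRx by metis
    finally show "Z = (\<Sum>k\<in>UNIV. (Z \<bullet> \<sigma> k) *\<^sub>R \<sigma> k)" using RRx by simp
  next
    fix k
    have mm: "m \<bullet> m = 2 * (1 - \<nu> \<bullet> e)" and tm: "\<tau> k \<bullet> m = - (e \<bullet> \<tau> k)"
      using unit unit_e tangent[of k] unfolding m_def
      by (simp_all add: inner_diff_left inner_diff_right inner_commute norm_eq_sqrt_inner)
    have "\<tau> k - \<sigma> k = (2 * (\<tau> k \<bullet> m) / (m \<bullet> m)) *\<^sub>R m"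
      unfolding \<sigma>_def R_def reflect_along_def by simp
    then have "(norm (\<tau> k - \<sigma> k))\<^sup>2 = (2 * (\<tau> k \<bullet> m) / (m \<bullet> m))\<^sup>2 * (m \<bullet> m)"
      unfolding power2_norm_eq_inner by (simp add: power2_eq_square)
    also have "\<dots> = 2 * (e \<bullet> \<tau> k)\<^sup>2 / (1 - \<nu> \<bullet> e)"
    proof -
      have "1 - \<nu> \<bullet> e \<noteq> 0" using obtuse by simp
      then show ?thesis unfolding mm tm by (simp add: power2_eq_square divide_simps)
    qed
    also have "\<dots> \<le> 2 * (e \<bullet> \<tau> k)\<^sup>2"
      using obtuse by (simp add: divide_le_eq mult_le_cancel_left1)
    finally show "(norm (\<tau> k - \<sigma> k))\<^sup>2 \<le> 2 * (e \<bullet> \<tau> k)\<^sup>2" .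
  qed
qed

section \<open>Derivatives in a chart\<close>

lemma has_vector_derivative_along_line_frechet:
  fixes g :: "'a::real_normed_vector \<Rightarrow> 'b::real_normed_vector"
  assumes "g differentiable (at (x + s *\<^sub>R b))"
  shows "((\<lambda>r. g (x + r *\<^sub>R b)) has_vector_derivative frechet_derivative g (at (x + s *\<^sub>R b)) b) (at s)"
proof -
  let ?F = "frechet_derivative g (at (x + s *\<^sub>R b))"
  have F: "(g has_derivative ?F) (at (x + s *\<^sub>R b))"
    using assms frechet_derivative_works by blast
  have "((\<lambda>r. x + r *\<^sub>R b) has_derivative (\<lambda>r. r *\<^sub>R b)) (at s)"
    by (auto intro!: derivative_eq_intros)
  then have "((\<lambda>r. g (x + r *\<^sub>R b)) has_derivative (\<lambda>r. ?F (r *\<^sub>R b))) (at s)"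
    using has_derivative_compose F by blast
  then show ?thesis
    unfolding has_vector_derivative_def
    using linear_scale[OF has_derivative_linear[OF F]] by simp
qed

lemma dirD_eq_frechet_derivative:
  fixes g :: "'a::real_normed_vector \<Rightarrow> 'b::real_normed_vector"
  assumes "g differentiable (at x)"
  shows "dirD b g x = frechet_derivative g (at x) b"
  using has_vector_derivative_along_line_frechet[of g x 0 b] assms
  unfolding dirD_def by (simp add: vector_derivative_at)

lemma has_vector_derivative_along_line:
  fixes g :: "'a::real_normed_vector \<Rightarrow> 'b::real_normed_vector"
  assumes "g differentiable (at (x + s *\<^sub>R b))"
  shows "((\<lambda>s. g (x + s *\<^sub>R b)) has_vector_derivative dirD b g (x + s *\<^sub>R b)) (at s)"
  using has_vector_derivative_along_line_frechet[OF assms] dirD_eq_frechet_derivative[OF assms]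
  by simp

lemma dirD_space_direction:
  fixes g :: "(real^'n::finite) \<times> real \<Rightarrow> 'b::real_normed_vector"
  assumes "g differentiable (at p)"
  shows "dirD (\<alpha>, 0) g p = (\<Sum>j\<in>UNIV. \<alpha> $ j *\<^sub>R Du j g p)"
proof -
  let ?F = "frechet_derivative g (at p)"
  have lin: "linear ?F" using assms frechet_derivative_works has_derivative_linear by blast
  have "(\<alpha>, 0::real) = (\<Sum>j\<in>UNIV. \<alpha> $ j *\<^sub>R (axis j 1, 0::real))"
    by (simp add: sum_prod vec_eq_iff axis_def if_distrib sum.delta cong: if_cong)
  then have "?F (\<alpha>, 0) = (\<Sum>j\<in>UNIV. ?F (\<alpha> $ j *\<^sub>R (axis j 1, 0::real)))"
    using linear_sum[OF lin] by (simp only: o_def)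
  also have "\<dots> = (\<Sum>j\<in>UNIV. \<alpha> $ j *\<^sub>R ?F (axis j 1, 0))"
    by (simp only: linear_scale[OF lin])
  finally have "?F (\<alpha>, 0) = (\<Sum>j\<in>UNIV. \<alpha> $ j *\<^sub>R ?F (axis j 1, 0))" .
  then show ?thesis using dirD_eq_frechet_derivative[OF assms] unfolding Du_def by simp
qed

lemma Ck_subset: "Ck k S f \<Longrightarrow> T \<subseteq> S \<Longrightarrow> Ck k T f"
  by (induction k arbitrary: f) (auto intro: continuous_on_subset)

lemma Ck2_differentiable: "Ck 2 S g \<Longrightarrow> p \<in> S \<Longrightarrow> g differentiable (at p)"
  by (simp add: numeral_2_eq_2)

lemma Ck2_Du_differentiable:
  fixes g :: "(real^'n::finite) \<times> real \<Rightarrow> 'b::real_normed_vector"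
  assumes "Ck 2 S g" "p \<in> S"
  shows "Du j g differentiable (at p)"
proof -
  have "(axis j 1, 0) \<in> (Basis :: ((real^'n) \<times> real) set)"
    unfolding Basis_prod_def by (rule UnI1, rule image_eqI[OF refl]) simp
  then have "Ck 1 S (dirD (axis j 1, 0) g)" using assms(1) by (simp add: numeral_2_eq_2)
  moreover have "Du j g = dirD (axis j 1, 0) g" unfolding Du_def by (rule ext) simp
  ultimately show ?thesis using assms(2) by simp
qed

lemma Ck2_space_line_derivative:
  fixes g :: "(real^'n::finite) \<times> real \<Rightarrow> 'b::real_normed_vector"
  assumes "Ck 2 S g" "p + s *\<^sub>R (\<alpha>, 0) \<in> S"
  shows "((\<lambda>s. g (p + s *\<^sub>R (\<alpha>, 0))) has_vector_derivative
           (\<Sum>j\<in>UNIV. \<alpha> $ j *\<^sub>R Du j g (p + s *\<^sub>R (\<alpha>, 0)))) (at s)"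
  using has_vector_derivative_along_line[of g p s "(\<alpha>, 0)"]
    dirD_space_direction[OF Ck2_differentiable[OF assms]] Ck2_differentiable[OF assms]
  by simp

lemma Ck2_space_line_second_derivative:
  fixes g :: "(real^'n::finite) \<times> real \<Rightarrow> 'b::real_normed_vector"
  assumes "Ck 2 S g" "p \<in> S"
  shows "((\<lambda>s. \<Sum>j\<in>UNIV. \<alpha> $ j *\<^sub>R Du j g (p + s *\<^sub>R (\<alpha>, 0))) has_vector_derivative
           (\<Sum>j\<in>UNIV. \<alpha> $ j *\<^sub>R (\<Sum>i\<in>UNIV. \<alpha> $ i *\<^sub>R Du i (Du j g) p))) (at 0)"
proof -
  have "((\<lambda>s. Du j g (p + s *\<^sub>R (\<alpha>, 0))) has_vector_derivative
           (\<Sum>i\<in>UNIV. \<alpha> $ i *\<^sub>R Du i (Du j g) p)) (at 0)" for j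
    using has_vector_derivative_along_line[of "Du j g" p 0 "(\<alpha>, 0)"]
      dirD_space_direction[OF Ck2_Du_differentiable[OF assms]] Ck2_Du_differentiable[OF assms]
    by (simp del: scaleR_Pair add: zero_prod_def[symmetric])
  then show ?thesis
    by (intro has_vector_derivative_sum bounded_linear.has_vector_derivative[OF bounded_linear_scaleR_right])
qed

lemma Ck2_time_derivative:
  fixes g :: "(real^'n::finite) \<times> real \<Rightarrow> 'b::real_normed_vector"
  assumes "Ck 2 S g" "(u, t) \<in> S"
  shows "((\<lambda>t. g (u, t)) has_vector_derivative Dt g (u, t)) (at t)"
proof -
  have line: "(u, 0) + s *\<^sub>R (0::real^'n, 1::real) = (u, s)" for s by simp
  show ?thesis
    using has_vector_derivative_along_line[of g "(u, 0)" t "(0, 1)"] Ck2_differentiable[OF assms]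
    unfolding Dt_def line by simp
qed

lemma sum_axis_scaleR: "(\<Sum>j\<in>UNIV. axis l (1::real) $ j *\<^sub>R (f j :: 'a::real_vector)) = f l"
  by (simp add: axis_def if_distrib[where f="\<lambda>x. x *\<^sub>R _"] sum.delta cong: if_cong)

lemma sum_axis_mult: "(\<Sum>j\<in>UNIV. axis l (1::real) $ j * f j) = f l"
  by (simp add: axis_def if_distrib[where f="\<lambda>x. x * _"] sum.delta cong: if_cong)

lemma DERIV_local_min_second_order:
  fixes k k1 :: "real \<Rightarrow> real"
  assumes \<delta>: "\<delta> > 0" and k: "\<And>s. \<bar>s\<bar> < \<delta> \<Longrightarrow> (k has_real_derivative k1 s) (at s)"
    and k1: "(k1 has_real_derivative D) (at 0)"
    and min: "\<And>s. \<bar>s\<bar> < \<delta> \<Longrightarrow> k 0 \<le> k s"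
  shows "k1 0 = 0" "D \<ge> 0"
proof -
  show k1_0: "k1 0 = 0"
    by (rule DERIV_local_min[OF k[of 0] \<delta>]) (use \<delta> min in auto)
  show "D \<ge> 0"
  proof (rule ccontr)
    assume "\<not> D \<ge> 0"
    then obtain d where d: "d > 0" "\<And>h. h > 0 \<Longrightarrow> h < d \<Longrightarrow> k1 h < k1 0"
      using DERIV_neg_dec_right[OF k1] by force
    define h where "h = min d \<delta> / 2"
    have h: "h > 0" "h < d" "h < \<delta>" using d \<delta> unfolding h_def by auto
    obtain z where z: "0 < z" "z < h" "k h - k 0 = h * k1 z"
      using MVT2[of 0 h k k1] h k by force
    have "k1 z < 0" using d(2)[of z] z h k1_0 by simp
    then have "h * k1 z < 0" using h by (simp add: mult_pos_neg)
    then have "k h < k 0" using z by simp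
    then show False using min[of h] h by simp
  qed
qed

lemma DERIV_left_local_min:
  fixes h :: "real \<Rightarrow> real"
  assumes h: "(h has_real_derivative D) (at t0)" and \<delta>: "\<delta> > 0"
    and min: "\<And>t. t0 - \<delta> < t \<Longrightarrow> t \<le> t0 \<Longrightarrow> h t0 \<le> h t"
  shows "D \<le> 0"
proof (rule ccontr)
  assume "\<not> D \<le> 0"
  then obtain d where d: "d > 0" "\<And>e. e > 0 \<Longrightarrow> e < d \<Longrightarrow> h (t0 - e) < h t0"
    using DERIV_pos_inc_left[OF h] by force
  define e where "e = min d \<delta> / 2"
  have "e > 0" "e < d" "e < \<delta>" using d \<delta> unfolding e_def by auto
  then show False using d(2) min[of "t0 - e"] by fastforce
qed

lemma open_contains_line:
  fixes p h :: "'a::real_normed_vector"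
  assumes "open S" "p \<in> S"
  obtains \<delta> where "\<delta> > 0" "\<And>s. \<bar>s\<bar> < \<delta> \<Longrightarrow> p + s *\<^sub>R h \<in> S"
proof -
  obtain e where e: "e > 0" "ball p e \<subseteq> S" using assms open_contains_ball by blast
  define \<delta> where "\<delta> = e / (norm h + 1)"
  have h1: "norm h + 1 > 0" by (simp add: add_nonneg_pos)
  have "p + s *\<^sub>R h \<in> S" if s: "\<bar>s\<bar> < \<delta>" for s
  proof -
    have "norm (s *\<^sub>R h) \<le> \<bar>s\<bar> * (norm h + 1)" by (simp add: mult_left_mono)
    also have "\<dots> < \<delta> * (norm h + 1)" using s h1 by (intro mult_strict_right_mono) auto
    also have "\<dots> = e" unfolding \<delta>_def using h1 by simp
    finally show ?thesis using e by (auto simp: dist_norm)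
  qed
  moreover have "\<delta> > 0" unfolding \<delta>_def using e h1 by simp
  ultimately show ?thesis using that by blast
qed

lemma has_real_derivative_inner:
  fixes f g :: "real \<Rightarrow> 'a::real_inner"
  assumes "(f has_vector_derivative f') (at s)" "(g has_vector_derivative g') (at s)"
  shows "((\<lambda>s. f s \<bullet> g s) has_real_derivative (f s \<bullet> g' + f' \<bullet> g s)) (at s)"
  using bounded_bilinear.has_vector_derivative[OF bounded_bilinear_inner assms]
  by (simp add: has_real_derivative_iff_has_vector_derivative)

section \<open>The doubled barrier\<close>

text \<open>With \<open>\<kappa> = 2n\<close> this is \<open>exp f(x,t) / |x - y|\<close>; for \<open>y\<close> a closest point of \<open>\<Sigma>_t\<close> it is \<open>e\<^sup>f d\<^sup>-\<^sup>1\<close>.\<close>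
definition barrier :: "real \<Rightarrow> real \<Rightarrow> 'a::real_normed_vector \<Rightarrow> real \<Rightarrow> 'a \<Rightarrow> 'a \<Rightarrow> real \<Rightarrow> real" where
  "barrier c1 c2 x0 \<kappa> x y t = exp (c1 + c2 * ((norm (x - x0))\<^sup>2 + \<kappa> * t)) / norm (x - y)"

text \<open>The logarithmic derivative of the barrier when \<open>x\<close> moves with velocity \<open>\<xi>\<close> and \<open>y\<close>
  with velocity \<open>\<eta>\<close>, at fixed time.\<close>
definition barrier_rate :: "real \<Rightarrow> 'a::real_inner \<Rightarrow> 'a \<Rightarrow> 'a \<Rightarrow> 'a \<Rightarrow> 'a \<Rightarrow> real" where
  "barrier_rate c2 x0 x y \<xi> \<eta> = 2 * c2 * ((x - x0) \<bullet> \<xi>) - ((x - y) \<bullet> (\<xi> - \<eta>)) / ((x - y) \<bullet> (x - y))"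

lemma barrier_has_derivative:
  fixes x y :: "real \<Rightarrow> 'a::real_inner"
  assumes x: "(x has_vector_derivative \<xi>) (at s)" and y: "(y has_vector_derivative \<eta>) (at s)"
    and t: "(t has_real_derivative t') (at s)" and xy: "x s \<noteq> y s"
  shows "((\<lambda>s. barrier c1 c2 x0 \<kappa> (x s) (y s) (t s)) has_real_derivative
           barrier c1 c2 x0 \<kappa> (x s) (y s) (t s) * (barrier_rate c2 x0 (x s) (y s) \<xi> \<eta> + c2 * \<kappa> * t'))
           (at s)"
proof -
  define m where "m = (\<lambda>s. (x s - x0) \<bullet> (x s - x0))"
  define q where "q = (\<lambda>s. (x s - y s) \<bullet> (x s - y s))"
  define E where "E = exp (c1 + c2 * (m s + \<kappa> * t s))"
  have "((\<lambda>s. x s - x0) has_vector_derivative \<xi>) (at s)"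
    using x by (intro derivative_eq_intros) auto
  from has_real_derivative_inner[OF this this]
  have m: "(m has_real_derivative 2 * ((x s - x0) \<bullet> \<xi>)) (at s)"
    unfolding m_def by (simp add: inner_commute)
  have "((\<lambda>s. x s - y s) has_vector_derivative \<xi> - \<eta>) (at s)"
    using x y by (intro derivative_eq_intros) auto
  from has_real_derivative_inner[OF this this]
  have q: "(q has_real_derivative 2 * ((x s - y s) \<bullet> (\<xi> - \<eta>))) (at s)"
    unfolding q_def by (simp add: inner_commute)
  have q_pos: "q s > 0" using xy unfolding q_def by simp
  have barrier_eq: "(\<lambda>s. barrier c1 c2 x0 \<kappa> (x s) (y s) (t s))
      = (\<lambda>s. exp (c1 + c2 * (m s + \<kappa> * t s)) / sqrt (q s))"
    unfolding barrier_def m_def q_def by (simp add: power2_norm_eq_inner norm_eq_sqrt_inner)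
  have "((\<lambda>s. exp (c1 + c2 * (m s + \<kappa> * t s)) / sqrt (q s)) has_real_derivative
      (E * (c2 * (2 * ((x s - x0) \<bullet> \<xi>) + \<kappa> * t')) * sqrt (q s)
        - E * (2 * ((x s - y s) \<bullet> (\<xi> - \<eta>)) * inverse (sqrt (q s)) / 2)) / (sqrt (q s) * sqrt (q s)))
      (at s)"
    unfolding E_def using q_pos by (auto intro!: derivative_eq_intros m q t)
  moreover have "(E * (c2 * (2 * ((x s - x0) \<bullet> \<xi>) + \<kappa> * t')) * sqrt (q s)
        - E * (2 * ((x s - y s) \<bullet> (\<xi> - \<eta>)) * inverse (sqrt (q s)) / 2)) / (sqrt (q s) * sqrt (q s))
      = E / sqrt (q s) * (barrier_rate c2 x0 (x s) (y s) \<xi> \<eta> + c2 * \<kappa> * t')"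
  proof -
    have "sqrt (q s) * (sqrt (q s) * z) = q s * z" for z
      using q_pos by (simp add: mult.assoc[symmetric])
    moreover have "(x s - y s) \<bullet> (x s - y s) = q s" unfolding q_def ..
    ultimately show ?thesis
      using q_pos unfolding barrier_rate_def by (simp add: field_simps)
  qed
  moreover have "barrier c1 c2 x0 \<kappa> (x s) (y s) (t s) = E / sqrt (q s)"
    using fun_cong[OF barrier_eq, of s] unfolding E_def by simp
  ultimately show ?thesis unfolding barrier_eq E_def by simp
qed

lemma barrier_rate_has_derivative:
  fixes x y \<xi> \<eta> :: "real \<Rightarrow> 'a::real_inner"
  assumes x: "(x has_vector_derivative \<xi> s) (at s)" and y: "(y has_vector_derivative \<eta> s) (at s)"
    and \<xi>: "(\<xi> has_vector_derivative \<xi>') (at s)" and \<eta>: "(\<eta> has_vector_derivative \<eta>') (at s)"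
    and xy: "x s \<noteq> y s"
  shows "((\<lambda>s. barrier_rate c2 x0 (x s) (y s) (\<xi> s) (\<eta> s)) has_real_derivative
           barrier_rate c2 x0 (x s) (y s) \<xi>' \<eta>' + 2 * c2 * (\<xi> s \<bullet> \<xi> s)
           - ((\<xi> s - \<eta> s) \<bullet> (\<xi> s - \<eta> s)) / ((x s - y s) \<bullet> (x s - y s))
           + 2 * ((x s - y s) \<bullet> (\<xi> s - \<eta> s))\<^sup>2 / ((x s - y s) \<bullet> (x s - y s))\<^sup>2) (at s)"
proof -
  define q where "q = (\<lambda>s. (x s - y s) \<bullet> (x s - y s))"
  define r where "r = (\<lambda>s. (x s - y s) \<bullet> (\<xi> s - \<eta> s))"
  have xy': "((\<lambda>s. x s - y s) has_vector_derivative \<xi> s - \<eta> s) (at s)"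
    using x y by (intro derivative_eq_intros) auto
  have \<xi>\<eta>': "((\<lambda>s. \<xi> s - \<eta> s) has_vector_derivative \<xi>' - \<eta>') (at s)"
    using \<xi> \<eta> by (intro derivative_eq_intros) auto
  have "((\<lambda>s. x s - x0) has_vector_derivative \<xi> s) (at s)"
    using x by (intro derivative_eq_intros) auto
  from has_real_derivative_inner[OF this \<xi>]
  have m: "((\<lambda>s. (x s - x0) \<bullet> \<xi> s) has_real_derivative (x s - x0) \<bullet> \<xi>' + \<xi> s \<bullet> \<xi> s) (at s)" .
  from has_real_derivative_inner[OF xy' xy']
  have q: "(q has_real_derivative 2 * r s) (at s)"
    unfolding q_def r_def by (simp add: inner_commute)
  from has_real_derivative_inner[OF xy' \<xi>\<eta>']
  have r: "(r has_real_derivative (x s - y s) \<bullet> (\<xi>' - \<eta>') + (\<xi> s - \<eta> s) \<bullet> (\<xi> s - \<eta> s)) (at s)"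
    unfolding r_def .
  have q_pos: "q s > 0" using xy unfolding q_def by simp
  have "((\<lambda>s. 2 * c2 * ((x s - x0) \<bullet> \<xi> s) - r s / q s) has_real_derivative
      2 * c2 * ((x s - x0) \<bullet> \<xi>' + \<xi> s \<bullet> \<xi> s)
      - (((x s - y s) \<bullet> (\<xi>' - \<eta>') + (\<xi> s - \<eta> s) \<bullet> (\<xi> s - \<eta> s)) * q s - r s * (2 * r s))
        / (q s * q s)) (at s)"
    using q_pos by (auto intro!: derivative_eq_intros m q r)
  moreover have "(\<lambda>s. barrier_rate c2 x0 (x s) (y s) (\<xi> s) (\<eta> s))
      = (\<lambda>s. 2 * c2 * ((x s - x0) \<bullet> \<xi> s) - r s / q s)"
    unfolding barrier_rate_def q_def r_def ..
  moreover have "(x s - y s) \<bullet> (x s - y s) = q s" "(x s - y s) \<bullet> (\<xi> s - \<eta> s) = r s"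
    unfolding q_def r_def by simp_all
  ultimately show ?thesis
    using q_pos unfolding barrier_rate_def by (simp add: field_simps power2_eq_square)
qed

lemma barrier_rate_split:
  "barrier_rate c2 x0 x y \<xi> \<eta> = barrier_rate c2 x0 x y \<xi> 0 + ((x - y) \<bullet> \<eta>) / ((x - y) \<bullet> (x - y))"
  unfolding barrier_rate_def by (simp add: inner_diff_right diff_divide_distrib)

lemma barrier_rate_sum:
  "barrier_rate c2 x0 x y (\<Sum>i\<in>S. \<xi> i) (\<Sum>i\<in>S. \<eta> i) = (\<Sum>i\<in>S. barrier_rate c2 x0 x y (\<xi> i) (\<eta> i))"
proof -
  define q where "q = (x - y) \<bullet> (x - y)"
  show ?thesis
    unfolding barrier_rate_def q_def[symmetric]
    by (simp add: inner_sum_right inner_diff_right sum_subtractf sum_distrib_left sum_divide_distrib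
        diff_divide_distrib)
qed

lemma barrier_rate_scaleR:
  "barrier_rate c2 x0 x y (a *\<^sub>R \<xi>) (a *\<^sub>R \<eta>) = a * barrier_rate c2 x0 x y \<xi> \<eta>"
  unfolding barrier_rate_def by (simp add: inner_diff_right right_diff_distrib)

lemma barrier_rate_add:
  "barrier_rate c2 x0 x y (\<xi> + \<xi>') (\<eta> + \<eta>') = barrier_rate c2 x0 x y \<xi> \<eta> + barrier_rate c2 x0 x y \<xi>' \<eta>'"
proof -
  define q where "q = (x - y) \<bullet> (x - y)"
  show ?thesis
    unfolding barrier_rate_def q_def[symmetric]
    by (simp add: inner_add_right inner_diff_right add_divide_distrib diff_divide_distrib distrib_left)
qed

lemma barrier_le_exp_div_infdist:
  fixes x y :: "'a::real_normed_vector"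
  assumes "y \<in> S" "closed S" "x \<notin> S"
  shows "barrier c1 c2 x0 \<kappa> x y t \<le> exp (c1 + c2 * ((norm (x - x0))\<^sup>2 + \<kappa> * t)) / infdist x S"
proof -
  have "0 < infdist x S" using infdist_pos_not_in_closed assms by blast
  moreover have "infdist x S \<le> norm (x - y)" using infdist_le[OF assms(1)] by (simp add: dist_norm)
  ultimately show ?thesis unfolding barrier_def by (intro divide_left_mono mult_pos_pos) auto
qed

lemma barrier_touching_second_order:
  fixes x y \<xi> \<eta> :: "real \<Rightarrow> 'a::real_inner" and \<phi> \<phi>1 :: "real \<Rightarrow> real"
  assumes \<delta>: "\<delta> > 0"
    and x: "\<And>s. \<bar>s\<bar> < \<delta> \<Longrightarrow> (x has_vector_derivative \<xi> s) (at s)"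
    and y: "\<And>s. \<bar>s\<bar> < \<delta> \<Longrightarrow> (y has_vector_derivative \<eta> s) (at s)"
    and \<phi>: "\<And>s. \<bar>s\<bar> < \<delta> \<Longrightarrow> (\<phi> has_real_derivative \<phi>1 s) (at s)"
    and \<xi>: "(\<xi> has_vector_derivative \<xi>') (at 0)" and \<eta>: "(\<eta> has_vector_derivative \<eta>') (at 0)"
    and \<phi>1: "(\<phi>1 has_real_derivative \<phi>2) (at 0)"
    and below: "\<And>s. \<bar>s\<bar> < \<delta> \<Longrightarrow> x s \<noteq> y s \<and> barrier c1 c2 x0 \<kappa> (x s) (y s) t \<le> \<phi> s"
    and touch: "\<phi> 0 = barrier c1 c2 x0 \<kappa> (x 0) (y 0) t"
  defines "R \<equiv> barrier_rate c2 x0 (x 0) (y 0) (\<xi> 0) (\<eta> 0)"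
    and "dR \<equiv> barrier_rate c2 x0 (x 0) (y 0) \<xi>' \<eta>' + 2 * c2 * (\<xi> 0 \<bullet> \<xi> 0)
           - ((\<xi> 0 - \<eta> 0) \<bullet> (\<xi> 0 - \<eta> 0)) / ((x 0 - y 0) \<bullet> (x 0 - y 0))
           + 2 * ((x 0 - y 0) \<bullet> (\<xi> 0 - \<eta> 0))\<^sup>2 / ((x 0 - y 0) \<bullet> (x 0 - y 0))\<^sup>2"
  shows "\<phi>1 0 = \<phi> 0 * R" and "\<phi> 0 * (R\<^sup>2 + dR) \<le> \<phi>2"
proof -
  define \<Psi> where "\<Psi> = (\<lambda>s. barrier c1 c2 x0 \<kappa> (x s) (y s) t)"
  define r where "r = (\<lambda>s. barrier_rate c2 x0 (x s) (y s) (\<xi> s) (\<eta> s))"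
  have \<Psi>: "(\<Psi> has_real_derivative \<Psi> s * r s) (at s)" if "\<bar>s\<bar> < \<delta>" for s
    using barrier_has_derivative[OF x[OF that] y[OF that] DERIV_const[of t] conjunct1[OF below[OF that]]]
    unfolding \<Psi>_def r_def by simp
  have r: "(r has_real_derivative dR) (at 0)"
    using barrier_rate_has_derivative[OF x[of 0] y[of 0] \<xi> \<eta>] below[of 0] \<delta>
    unfolding r_def dR_def by simp
  have \<Psi>r: "((\<lambda>s. \<Psi> s * r s) has_real_derivative \<Psi> 0 * (R\<^sup>2 + dR)) (at 0)"
    using DERIV_mult[OF \<Psi>[of 0] r] \<delta>
    unfolding r_def R_def by (simp add: algebra_simps power2_eq_square)
  have k: "((\<lambda>s. \<phi> s - \<Psi> s) has_real_derivative \<phi>1 s - \<Psi> s * r s) (at s)" if "\<bar>s\<bar> < \<delta>" for s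
    using \<phi>[OF that] \<Psi>[OF that] by (rule DERIV_diff)
  have k1: "((\<lambda>s. \<phi>1 s - \<Psi> s * r s) has_real_derivative \<phi>2 - \<Psi> 0 * (R\<^sup>2 + dR)) (at 0)"
    using \<phi>1 \<Psi>r by (rule DERIV_diff)
  have min: "\<phi> 0 - \<Psi> 0 \<le> \<phi> s - \<Psi> s" if "\<bar>s\<bar> < \<delta>" for s
    using below[OF that] touch unfolding \<Psi>_def by simp
  note DERIV_local_min_second_order[OF \<delta> k k1 min]
  moreover have "\<Psi> 0 = \<phi> 0" unfolding \<Psi>_def touch ..
  ultimately show "\<phi>1 0 = \<phi> 0 * R" "\<phi> 0 * (R\<^sup>2 + dR) \<le> \<phi>2"
    unfolding r_def R_def by simp_all
qed

lemma barrier_touching_from_past: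
  fixes x y :: "real \<Rightarrow> 'a::real_inner" and \<phi> :: "real \<Rightarrow> real"
  assumes \<delta>: "\<delta> > 0"
    and x: "(x has_vector_derivative \<xi>) (at t0)" and y: "(y has_vector_derivative \<eta>) (at t0)"
    and \<phi>: "(\<phi> has_real_derivative \<phi>') (at t0)"
    and below: "\<And>t. t0 - \<delta> < t \<Longrightarrow> t \<le> t0 \<Longrightarrow> barrier c1 c2 x0 \<kappa> (x t) (y t) t \<le> \<phi> t"
    and touch: "\<phi> t0 = barrier c1 c2 x0 \<kappa> (x t0) (y t0) t0" and xy: "x t0 \<noteq> y t0"
  shows "\<phi>' \<le> \<phi> t0 * (barrier_rate c2 x0 (x t0) (y t0) \<xi> \<eta> + c2 * \<kappa>)"
proof -
  define \<Psi> where "\<Psi> = (\<lambda>t. barrier c1 c2 x0 \<kappa> (x t) (y t) t)"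
  have "(\<Psi> has_real_derivative \<Psi> t0 * (barrier_rate c2 x0 (x t0) (y t0) \<xi> \<eta> + c2 * \<kappa> * 1)) (at t0)"
    unfolding \<Psi>_def by (rule barrier_has_derivative[OF x y DERIV_ident xy])
  from DERIV_diff[OF \<phi> this]
  have "\<phi>' - \<Psi> t0 * (barrier_rate c2 x0 (x t0) (y t0) \<xi> \<eta> + c2 * \<kappa> * 1) \<le> 0"
    by (rule DERIV_left_local_min[OF _ \<delta>]) (use below touch in \<open>auto simp: \<Psi>_def\<close>)
  then show ?thesis using touch unfolding \<Psi>_def by simp
qed

section \<open>Hypersurfaces and their slices\<close>

lemma trace_congruence:
  fixes M :: "'n::finite \<Rightarrow> 'n \<Rightarrow> 'b::real_vector"
  shows "(\<Sum>k\<in>UNIV. \<Sum>j\<in>UNIV. P j k *\<^sub>R (\<Sum>i\<in>UNIV. P i k *\<^sub>R M i j))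
       = (\<Sum>i\<in>UNIV. \<Sum>j\<in>UNIV. (\<Sum>k\<in>UNIV. P i k * P j k) *\<^sub>R M i j)"
proof -
  have "(\<Sum>k\<in>UNIV. \<Sum>j\<in>UNIV. P j k *\<^sub>R (\<Sum>i\<in>UNIV. P i k *\<^sub>R M i j))
      = (\<Sum>k\<in>UNIV. \<Sum>j\<in>UNIV. \<Sum>i\<in>UNIV. (P i k * P j k) *\<^sub>R M i j)"
    by (simp add: scaleR_sum_right mult.commute)
  also have "\<dots> = (\<Sum>i\<in>UNIV. \<Sum>j\<in>UNIV. \<Sum>k\<in>UNIV. (P i k * P j k) *\<^sub>R M i j)"
    by (subst sum.swap, subst (2) sum.swap, rule sum.cong[OF refl], rule sum.swap)
  finally show ?thesis by (simp add: scaleR_sum_left)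
qed

lemma trace_hessian_tangent_normal:
  fixes X N :: "(real^'n::finite) \<times> real \<Rightarrow> real^'N::finite"
  assumes indep: "lin_indep_family (\<lambda>i. Du i X p)" and orth: "\<forall>i. N p \<bullet> Du i X p = 0"
    and unit: "norm (N p) = 1" and dim: "CARD('N) = CARD('n) + 1"
  shows "(\<Sum>i\<in>UNIV. \<Sum>j\<in>UNIV. ginv X p $ i $ j *\<^sub>R Du i (Du j X) p)
       = (\<Sum>l\<in>UNIV. (\<Sum>i\<in>UNIV. \<Sum>j\<in>UNIV. ginv X p $ i $ j * christoffel X l i j p) *\<^sub>R Du l X p)
         + mean_curv X N p *\<^sub>R N p"
proof -
  let ?g = "ginv X p"
  have "(\<Sum>i\<in>UNIV. \<Sum>j\<in>UNIV. ?g $ i $ j *\<^sub>R Du i (Du j X) p)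
      = (\<Sum>i\<in>UNIV. \<Sum>j\<in>UNIV. ?g $ i $ j *\<^sub>R
           ((\<Sum>l\<in>UNIV. christoffel X l i j p *\<^sub>R Du l X p) + (Du i (Du j X) p \<bullet> N p) *\<^sub>R N p))"
    by (subst tangent_normal_decomposition[OF indep orth unit dim])
      (simp add: christoffel_def ginv_def gmat_def)
  also have "\<dots> = (\<Sum>i\<in>UNIV. \<Sum>j\<in>UNIV. \<Sum>l\<in>UNIV. (?g $ i $ j * christoffel X l i j p) *\<^sub>R Du l X p)
      + (\<Sum>i\<in>UNIV. \<Sum>j\<in>UNIV. (?g $ i $ j * (Du i (Du j X) p \<bullet> N p)) *\<^sub>R N p)"
    by (simp add: scaleR_add_right sum.distrib scaleR_sum_right)
  also have "(\<Sum>i\<in>UNIV. \<Sum>j\<in>UNIV. \<Sum>l\<in>UNIV. (?g $ i $ j * christoffel X l i j p) *\<^sub>R Du l X p)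
      = (\<Sum>l\<in>UNIV. \<Sum>i\<in>UNIV. \<Sum>j\<in>UNIV. (?g $ i $ j * christoffel X l i j p) *\<^sub>R Du l X p)"
    by (subst sum.swap, rule sum.cong[OF refl], rule sum.swap)
  finally show ?thesis by (simp add: scaleR_sum_left mean_curv_def)
qed

lemma laplace_beltrami_expand:
  "laplace_beltrami X u p
     = (\<Sum>i\<in>UNIV. \<Sum>j\<in>UNIV. ginv X p $ i $ j * Du i (Du j u) p)
       - (\<Sum>k\<in>UNIV. (\<Sum>i\<in>UNIV. \<Sum>j\<in>UNIV. ginv X p $ i $ j * christoffel X k i j p) * Du k u p)"
proof -
  have "(\<Sum>i\<in>UNIV. \<Sum>j\<in>UNIV. ginv X p $ i $ j * (\<Sum>k\<in>UNIV. christoffel X k i j p * Du k u p))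
      = (\<Sum>k\<in>UNIV. (\<Sum>i\<in>UNIV. \<Sum>j\<in>UNIV. ginv X p $ i $ j * christoffel X k i j p) * Du k u p)"
    by (simp add: sum_distrib_left sum_distrib_right mult_ac, subst sum.swap,
        rule sum.cong[OF refl], subst sum.swap, simp)
  then show ?thesis
    unfolding laplace_beltrami_def by (simp add: right_diff_distrib sum_subtractf)
qed

lemma continuous_on_atlas:
  fixes B :: "((real^'n::finite) set \<times> (real^'n \<Rightarrow> 'q::topological_space)) set"
    and G :: "'q \<Rightarrow> real \<Rightarrow> 'b::topological_space"
  assumes atlas: "smooth_atlas B"
    and charts: "\<forall>(V,\<rho>)\<in>B. continuous_on (V \<times> I) (\<lambda>(v,t). G (\<rho> v) t)" and t: "t \<in> I"
  shows "continuous_on UNIV (\<lambda>q. G q t)"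
  unfolding continuous_on_def
proof (intro ballI)
  fix q :: 'q
  have "q \<in> (\<Union>(V,\<rho>)\<in>B. \<rho> ` V)" using atlas unfolding smooth_atlas_def by simp
  then obtain V \<rho> where VB: "(V, \<rho>) \<in> B" and qV: "q \<in> \<rho> ` V" by blast
  obtain \<phi> where hom: "homeomorphism V (\<rho> ` V) \<rho> \<phi>" and open_image: "open (\<rho> ` V)"
    using atlas VB unfolding smooth_atlas_def by blast
  have "continuous_on (\<rho> ` V) ((\<lambda>(v,t). G (\<rho> v) t) \<circ> (\<lambda>y. (\<phi> y, t)))"
  proof (rule continuous_on_compose)
    show "continuous_on (\<rho> ` V) (\<lambda>y. (\<phi> y, t))"
      using hom unfolding homeomorphism_def by (intro continuous_on_Pair continuous_on_const) auto
    show "continuous_on ((\<lambda>y. (\<phi> y, t)) ` \<rho> ` V) (\<lambda>(v,t). G (\<rho> v) t)"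
      by (rule continuous_on_subset[of "V \<times> I"]) (use charts VB hom t in \<open>auto simp: homeomorphism_def\<close>)
  qed
  then have "continuous_on (\<rho> ` V) (\<lambda>y. G y t)"
    by (rule continuous_on_eq) (use hom in \<open>auto simp: homeomorphism_def\<close>)
  then have "((\<lambda>y. G y t) \<longlongrightarrow> G q t) (at q within \<rho> ` V)"
    using qV unfolding continuous_on_def by blast
  then show "((\<lambda>q. G q t) \<longlongrightarrow> G q t) (at q within UNIV)"
    using at_within_open[OF qV open_image] by simp
qed

lemma proper_continuous_range_closed:
  fixes g :: "'a::topological_space \<Rightarrow> 'b::heine_borel"
  assumes cont: "continuous_on UNIV g" and proper: "proper_fun g"
  shows "closed (range g)"
proof -
  have "x \<in> range g" if x: "x \<in> closure (range g)" for x
  proof -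
    let ?C = "g -` cball x 1"
    have "compact (g ` ?C)"
      using proper cont compact_cball unfolding proper_fun_def
      by (intro compact_continuous_image) (auto intro: continuous_on_subset)
    then have "closed (g ` ?C)" by (rule compact_imp_closed)
    moreover have "x \<in> closure (g ` ?C)"
      unfolding closure_approachable
    proof (intro allI impI)
      fix e :: real assume "e > 0"
      then obtain y where "y \<in> range g" "dist y x < min e 1"
        using x unfolding closure_approachable by (meson less_numeral_extra(1) min_less_iff_conj)
      then show "\<exists>y\<in>g ` ?C. dist y x < e" by (auto simp: dist_commute)
    qed
    ultimately show "x \<in> range g" using closure_closed by auto
  qed
  then show ?thesis using closure_subset_eq by blast
qed

lemma mcf_chartD:
  assumes "mcf A I F N" and "(U, \<psi>) \<in> A"
  defines "X \<equiv> \<lambda>(u,t). F (\<psi> u) t" and "\<nu> \<equiv> \<lambda>(u,t). N (\<psi> u) t"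
  shows "open U" "open I" "smooth_on (U \<times> I) X"
    and "\<And>u t. u \<in> U \<Longrightarrow> t \<in> I \<Longrightarrow>
           lin_indep_family (\<lambda>i. Du i X (u, t)) \<and> (\<forall>i. \<nu> (u, t) \<bullet> Du i X (u, t) = 0)
           \<and> norm (\<nu> (u, t)) = 1 \<and> Dt X (u, t) = mean_curv X \<nu> (u, t) *\<^sub>R \<nu> (u, t)"
  using assms unfolding mcf_def smooth_atlas_def lin_indep_family_def X_def \<nu>_def by auto

lemma mcf_slice_closed:
  assumes "mcf B I G NS" "t \<in> I" "proper_fun (\<lambda>q. G q t)"
  shows "closed (range (\<lambda>q. G q t))"
proof (rule proper_continuous_range_closed[OF _ assms(3)])
  have "smooth_atlas B" "\<forall>(V,\<rho>)\<in>B. continuous_on (V \<times> I) (\<lambda>(v,t). G (\<rho> v) t)"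
    using assms(1) unfolding mcf_def smooth_on_def by (fastforce dest: spec[of _ 0])+
  then show "continuous_on UNIV (\<lambda>q. G q t)" using assms(2) by (rule continuous_on_atlas)
qed

lemma mcf_nearest_point_chart:
  assumes Sigma: "mcf B I G NS" and t: "t \<in> I" and proper: "proper_fun (\<lambda>q. G q t)"
  obtains V \<rho> v where "(V, \<rho>) \<in> B" "v \<in> V" "infdist x (range (\<lambda>q. G q t)) = norm (x - G (\<rho> v) t)"
proof -
  obtain q where "infdist x (range (\<lambda>q. G q t)) = dist x (G q t)"
    using infdist_attains_inf[OF mcf_slice_closed[OF Sigma t proper], of x] by auto
  moreover have "q \<in> (\<Union>(V,\<rho>)\<in>B. \<rho> ` V)"
    using Sigma unfolding mcf_def smooth_atlas_def by simp
  ultimately show ?thesis using that by (auto simp: dist_norm)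
qed

section \<open>Contact with the doubled barrier at a closest point\<close>

locale touching_charts =
  fixes X Y NX NY :: "(real^'n::finite) \<times> real \<Rightarrow> real^'N::finite"
    and Phi :: "(real^'n) \<times> real \<Rightarrow> real"
    and W V :: "((real^'n) \<times> real) set"
    and u0 v0 :: "real^'n" and t0 c1 c2 :: real and x0 :: "real^'N"
  assumes dim: "CARD('N) = CARD('n) + 1"
    and open_W: "open W" and p0_W: "(u0, t0) \<in> W" and open_V: "open V" and q0_V: "(v0, t0) \<in> V"
    and X_C2: "Ck 2 W X" and Phi_C2: "Ck 2 W Phi" and Y_C2: "Ck 2 V Y"
    and X_frame: "lin_indep_family (\<lambda>i. Du i X (u0, t0))" "\<forall>i. NX (u0, t0) \<bullet> Du i X (u0, t0) = 0"
      "norm (NX (u0, t0)) = 1"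
    and Y_frame: "lin_indep_family (\<lambda>i. Du i Y (v0, t0))" "\<forall>i. NY (v0, t0) \<bullet> Du i Y (v0, t0) = 0"
      "norm (NY (v0, t0)) = 1"
    and X_flow: "Dt X (u0, t0) = mean_curv X NX (u0, t0) *\<^sub>R NX (u0, t0)"
    and Y_flow: "Dt Y (v0, t0) = mean_curv Y NY (v0, t0) *\<^sub>R NY (v0, t0)"
    and below: "\<And>u v t. (u, t) \<in> W \<Longrightarrow> (v, t) \<in> V \<Longrightarrow> t \<le> t0 \<Longrightarrow>
      X (u, t) \<noteq> Y (v, t) \<and> barrier c1 c2 x0 (2 * real CARD('n)) (X (u, t)) (Y (v, t)) t \<le> Phi (u, t)"
    and touch: "Phi (u0, t0) = barrier c1 c2 x0 (2 * real CARD('n)) (X (u0, t0)) (Y (v0, t0)) t0"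
begin

abbreviation "p0 \<equiv> (u0, t0)"
abbreviation "q0 \<equiv> (v0, t0)"
abbreviation "gap \<equiv> X p0 - Y q0"
abbreviation "rate \<equiv> barrier_rate c2 x0 (X p0) (Y q0)"

lemma gap_nonzero: "gap \<noteq> 0" and gap_sq_pos: "gap \<bullet> gap > 0" and Phi_pos: "Phi p0 > 0"
  using below[OF p0_W q0_V order_refl] touch by (simp_all add: barrier_def)

lemma spatial_touching:
  fixes \<alpha> \<beta> :: "real^'n"
  defines "\<xi> \<equiv> \<Sum>j\<in>UNIV. \<alpha> $ j *\<^sub>R Du j X p0" and "\<eta> \<equiv> \<Sum>j\<in>UNIV. \<beta> $ j *\<^sub>R Du j Y q0"
    and "\<xi>' \<equiv> \<Sum>j\<in>UNIV. \<alpha> $ j *\<^sub>R (\<Sum>i\<in>UNIV. \<alpha> $ i *\<^sub>R Du i (Du j X) p0)"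
    and "\<eta>' \<equiv> \<Sum>j\<in>UNIV. \<beta> $ j *\<^sub>R (\<Sum>i\<in>UNIV. \<beta> $ i *\<^sub>R Du i (Du j Y) q0)"
  shows "(\<Sum>j\<in>UNIV. \<alpha> $ j * Du j Phi p0) = Phi p0 * rate \<xi> \<eta>"
    and "Phi p0 * ((rate \<xi> \<eta>)\<^sup>2 + (rate \<xi>' \<eta>' + 2 * c2 * (\<xi> \<bullet> \<xi>)
            - ((\<xi> - \<eta>) \<bullet> (\<xi> - \<eta>)) / (gap \<bullet> gap) + 2 * (gap \<bullet> (\<xi> - \<eta>))\<^sup>2 / (gap \<bullet> gap)\<^sup>2))
         \<le> (\<Sum>j\<in>UNIV. \<alpha> $ j * (\<Sum>i\<in>UNIV. \<alpha> $ i * Du i (Du j Phi) p0))"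
proof -
  obtain \<delta>1 where \<delta>1: "\<delta>1 > 0" "\<And>s. \<bar>s\<bar> < \<delta>1 \<Longrightarrow> p0 + s *\<^sub>R (\<alpha>, 0) \<in> W"
    using open_contains_line[OF open_W p0_W] by blast
  obtain \<delta>2 where \<delta>2: "\<delta>2 > 0" "\<And>s. \<bar>s\<bar> < \<delta>2 \<Longrightarrow> q0 + s *\<^sub>R (\<beta>, 0) \<in> V"
    using open_contains_line[OF open_V q0_V] by blast
  define \<delta> where "\<delta> = min \<delta>1 \<delta>2"
  have \<delta>: "\<delta> > 0" using \<delta>1 \<delta>2 unfolding \<delta>_def by simp
  have in_W: "p0 + s *\<^sub>R (\<alpha>, 0) \<in> W" and in_V: "q0 + s *\<^sub>R (\<beta>, 0) \<in> V" if "\<bar>s\<bar> < \<delta>" for s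
    using \<delta>1 \<delta>2 that unfolding \<delta>_def by auto
  define x where "x = (\<lambda>s. X (p0 + s *\<^sub>R (\<alpha>, 0)))"
  define y where "y = (\<lambda>s. Y (q0 + s *\<^sub>R (\<beta>, 0)))"
  define \<phi> where "\<phi> = (\<lambda>s. Phi (p0 + s *\<^sub>R (\<alpha>, 0)))"
  define xd where "xd = (\<lambda>s. \<Sum>j\<in>UNIV. \<alpha> $ j *\<^sub>R Du j X (p0 + s *\<^sub>R (\<alpha>, 0)))"
  define yd where "yd = (\<lambda>s. \<Sum>j\<in>UNIV. \<beta> $ j *\<^sub>R Du j Y (q0 + s *\<^sub>R (\<beta>, 0)))"
  define \<phi>d where "\<phi>d = (\<lambda>s. \<Sum>j\<in>UNIV. \<alpha> $ j *\<^sub>R Du j Phi (p0 + s *\<^sub>R (\<alpha>, 0)))"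
  have x: "(x has_vector_derivative xd s) (at s)" and y: "(y has_vector_derivative yd s) (at s)"
    and \<phi>: "(\<phi> has_real_derivative \<phi>d s) (at s)" if "\<bar>s\<bar> < \<delta>" for s
    using Ck2_space_line_derivative[OF X_C2 in_W[OF that]] Ck2_space_line_derivative[OF Y_C2 in_V[OF that]]
      Ck2_space_line_derivative[OF Phi_C2 in_W[OF that]]
    unfolding x_def y_def \<phi>_def xd_def yd_def \<phi>d_def
    by (simp_all add: has_real_derivative_iff_has_vector_derivative)
  have xd: "(xd has_vector_derivative \<xi>') (at 0)" and yd: "(yd has_vector_derivative \<eta>') (at 0)"
    and \<phi>d: "(\<phi>d has_real_derivative (\<Sum>j\<in>UNIV. \<alpha> $ j * (\<Sum>i\<in>UNIV. \<alpha> $ i * Du i (Du j Phi) p0))) (at 0)"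
    using Ck2_space_line_second_derivative[OF X_C2 p0_W, of \<alpha>]
      Ck2_space_line_second_derivative[OF Y_C2 q0_V, of \<beta>]
      Ck2_space_line_second_derivative[OF Phi_C2 p0_W, of \<alpha>]
    unfolding xd_def yd_def \<phi>d_def \<xi>'_def \<eta>'_def
    by (simp_all add: has_real_derivative_iff_has_vector_derivative)
  have "x s \<noteq> y s \<and> barrier c1 c2 x0 (2 * real CARD('n)) (x s) (y s) t0 \<le> \<phi> s" if "\<bar>s\<bar> < \<delta>" for s
    using below[of "u0 + s *\<^sub>R \<alpha>" t0 "v0 + s *\<^sub>R \<beta>"] in_W[OF that] in_V[OF that]
    unfolding x_def y_def \<phi>_def by simp
  note touching = barrier_touching_second_order[OF \<delta> x y \<phi> xd yd \<phi>d this]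
  have at_0: "x 0 = X p0" "y 0 = Y q0" "\<phi> 0 = Phi p0" "xd 0 = \<xi>" "yd 0 = \<eta>"
    "\<phi>d 0 = (\<Sum>j\<in>UNIV. \<alpha> $ j * Du j Phi p0)"
    unfolding x_def y_def \<phi>_def xd_def yd_def \<phi>d_def \<xi>_def \<eta>_def by simp_all
  show "(\<Sum>j\<in>UNIV. \<alpha> $ j * Du j Phi p0) = Phi p0 * rate \<xi> \<eta>"
    using touching(1) touch unfolding at_0 by simp
  show "Phi p0 * ((rate \<xi> \<eta>)\<^sup>2 + (rate \<xi>' \<eta>' + 2 * c2 * (\<xi> \<bullet> \<xi>)
            - ((\<xi> - \<eta>) \<bullet> (\<xi> - \<eta>)) / (gap \<bullet> gap) + 2 * (gap \<bullet> (\<xi> - \<eta>))\<^sup>2 / (gap \<bullet> gap)\<^sup>2))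
         \<le> (\<Sum>j\<in>UNIV. \<alpha> $ j * (\<Sum>i\<in>UNIV. \<alpha> $ i * Du i (Du j Phi) p0))"
    using touching(2) touch unfolding at_0 by simp
qed

lemma time_touching:
  "Dt Phi p0 \<le> Phi p0 * (rate (Dt X p0) (Dt Y q0) + c2 * (2 * real CARD('n)))"
proof -
  obtain \<delta>1 where \<delta>1: "\<delta>1 > 0" "\<And>s. \<bar>s\<bar> < \<delta>1 \<Longrightarrow> p0 + s *\<^sub>R (0, 1) \<in> W"
    using open_contains_line[OF open_W p0_W] by blast
  obtain \<delta>2 where \<delta>2: "\<delta>2 > 0" "\<And>s. \<bar>s\<bar> < \<delta>2 \<Longrightarrow> q0 + s *\<^sub>R (0, 1) \<in> V"
    using open_contains_line[OF open_V q0_V] by blast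
  have \<delta>: "min \<delta>1 \<delta>2 > 0" using \<delta>1 \<delta>2 by simp
  have "barrier c1 c2 x0 (2 * real CARD('n)) (X (u0, t)) (Y (v0, t)) t \<le> Phi (u0, t)"
    if "t0 - min \<delta>1 \<delta>2 < t" "t \<le> t0" for t
    using below[of u0 t v0] \<delta>1(2)[of "t - t0"] \<delta>2(2)[of "t - t0"] that by simp
  moreover have "((\<lambda>t. Phi (u0, t)) has_real_derivative Dt Phi p0) (at t0)"
    using Ck2_time_derivative[OF Phi_C2 p0_W] by (simp add: has_real_derivative_iff_has_vector_derivative)
  ultimately show ?thesis
    using barrier_touching_from_past[OF \<delta> Ck2_time_derivative[OF X_C2 p0_W] Ck2_time_derivative[OF Y_C2 q0_V]]
      touch gap_nonzero by simp
qed

lemma tangential_derivatives: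
  shows "Du l Phi p0 = Phi p0 * rate (Du l X p0) 0" and "gap \<bullet> Du l Y q0 = 0"
proof -
  show "Du l Phi p0 = Phi p0 * rate (Du l X p0) 0"
    using spatial_touching(1)[of "axis l 1" 0] by (simp add: sum_axis_scaleR sum_axis_mult)
  have "0 = Phi p0 * rate 0 (Du l Y q0)"
    using spatial_touching(1)[of 0 "axis l 1"] by (simp add: sum_axis_scaleR)
  then show "gap \<bullet> Du l Y q0 = 0"
    using Phi_pos gap_sq_pos unfolding barrier_rate_def by simp
qed

lemma gap_normal: "gap = (gap \<bullet> NY q0) *\<^sub>R NY q0"
  using tangent_normal_decomposition[OF Y_frame dim, of gap] tangential_derivatives(2) by simp

lemma inner_gap_eq_0_iff: "gap \<bullet> Z = 0 \<longleftrightarrow> Z \<bullet> NY q0 = 0"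
proof -
  have "gap \<bullet> NY q0 \<noteq> 0" using gap_normal gap_nonzero by (metis scaleR_zero_left)
  moreover have "gap \<bullet> Z = (gap \<bullet> NY q0) * (Z \<bullet> NY q0)"
    using arg_cong[OF gap_normal, of "\<lambda>v. v \<bullet> Z"] by (simp add: inner_commute)
  ultimately show ?thesis by simp
qed

lemma frames_along_gap:
  obtains \<tau> \<sigma> :: "'n \<Rightarrow> real^'N"
  where "\<And>k. \<tau> k \<bullet> NX p0 = 0" "\<And>Z. Z \<bullet> NX p0 = 0 \<Longrightarrow> Z = (\<Sum>k\<in>UNIV. (Z \<bullet> \<tau> k) *\<^sub>R \<tau> k)"
    "\<And>k. \<sigma> k \<bullet> NY q0 = 0" "\<And>Z. Z \<bullet> NY q0 = 0 \<Longrightarrow> Z = (\<Sum>k\<in>UNIV. (Z \<bullet> \<sigma> k) *\<^sub>R \<sigma> k)"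
    "\<And>k. norm (\<tau> k) = 1" "\<And>k. gap \<bullet> \<sigma> k = 0"
    "\<And>k. (norm (\<tau> k - \<sigma> k))\<^sup>2 \<le> 2 * (gap \<bullet> \<tau> k)\<^sup>2 / (gap \<bullet> gap)"
proof -
  define e where "e = (1 / norm gap) *\<^sub>R gap"
  have e: "norm e = 1" unfolding e_def using gap_nonzero by simp
  have e_inner: "e \<bullet> Z = (gap \<bullet> Z) / norm gap" for Z
    unfolding e_def inner_scaleR_left by simp
  have e_gap: "Z \<bullet> e = 0 \<longleftrightarrow> gap \<bullet> Z = 0" for Z
    using e_inner[of Z] gap_nonzero by (simp only: inner_commute[of Z e]) simp
  have e_\<tau>: "(e \<bullet> Z)\<^sup>2 = (gap \<bullet> Z)\<^sup>2 / (gap \<bullet> gap)" for Z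
    unfolding e_inner by (simp add: power_divide power2_norm_eq_inner)
  \<comment> \<open>only the orthogonal complement of the normal matters, so its sign may be chosen
    to make an obtuse angle with the gap\<close>
  define \<nu> where "\<nu> = (if NX p0 \<bullet> e \<le> 0 then NX p0 else - NX p0)"
  have \<nu>: "norm \<nu> = 1" "\<nu> \<bullet> e \<le> 0" and \<nu>_perp: "Z \<bullet> \<nu> = 0 \<longleftrightarrow> Z \<bullet> NX p0 = 0" for Z
    unfolding \<nu>_def using X_frame(3) by auto
  obtain \<tau> :: "'n \<Rightarrow> real^'N" where \<tau>: "\<And>k. norm (\<tau> k) = 1" "\<And>k. \<tau> k \<bullet> \<nu> = 0"
    "\<And>Z. Z \<bullet> \<nu> = 0 \<Longrightarrow> Z = (\<Sum>k\<in>UNIV. (Z \<bullet> \<tau> k) *\<^sub>R \<tau> k)"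
    using hyperplane_orthonormal_frame[OF \<nu>(1) dim] by blast
  obtain \<sigma> :: "'n \<Rightarrow> real^'N" where \<sigma>: "\<And>k. \<sigma> k \<bullet> e = 0" "\<And>Z. Z \<bullet> e = 0 \<Longrightarrow> Z = (\<Sum>k\<in>UNIV. (Z \<bullet> \<sigma> k) *\<^sub>R \<sigma> k)"
    "\<And>k. (norm (\<tau> k - \<sigma> k))\<^sup>2 \<le> 2 * (e \<bullet> \<tau> k)\<^sup>2"
    using reflected_orthonormal_frame[OF \<nu>(1) e \<nu>(2) \<tau>(2,3)] by blast
  show ?thesis
  proof (rule that[of \<tau> \<sigma>])
    show "\<tau> k \<bullet> NX p0 = 0" for k using \<tau>(2) \<nu>_perp by simp
    show "Z = (\<Sum>k\<in>UNIV. (Z \<bullet> \<tau> k) *\<^sub>R \<tau> k)" if "Z \<bullet> NX p0 = 0" for Z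
      by (rule \<tau>(3)) (simp add: \<nu>_perp that)
    show gap_\<sigma>: "gap \<bullet> \<sigma> k = 0" for k using \<sigma>(1) e_gap by simp
    show "\<sigma> k \<bullet> NY q0 = 0" for k using gap_\<sigma> inner_gap_eq_0_iff by simp
    show "Z = (\<Sum>k\<in>UNIV. (Z \<bullet> \<sigma> k) *\<^sub>R \<sigma> k)" if "Z \<bullet> NY q0 = 0" for Z
      by (rule \<sigma>(2)) (simp add: e_gap inner_gap_eq_0_iff that)
    show "norm (\<tau> k) = 1" for k by (rule \<tau>(1))
    show "(norm (\<tau> k - \<sigma> k))\<^sup>2 \<le> 2 * (gap \<bullet> \<tau> k)\<^sup>2 / (gap \<bullet> gap)" for k
      using \<sigma>(3)[of k] e_\<tau>[of "\<tau> k"] by simp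
  qed
qed

lemma second_variation_bound:
  fixes \<alpha> \<beta> :: "real^'n"
  defines "\<xi> \<equiv> \<Sum>j\<in>UNIV. \<alpha> $ j *\<^sub>R Du j X p0" and "\<eta> \<equiv> \<Sum>j\<in>UNIV. \<beta> $ j *\<^sub>R Du j Y q0"
    and "\<xi>' \<equiv> \<Sum>j\<in>UNIV. \<alpha> $ j *\<^sub>R (\<Sum>i\<in>UNIV. \<alpha> $ i *\<^sub>R Du i (Du j X) p0)"
    and "\<eta>' \<equiv> \<Sum>j\<in>UNIV. \<beta> $ j *\<^sub>R (\<Sum>i\<in>UNIV. \<beta> $ i *\<^sub>R Du i (Du j Y) q0)"
  assumes unit: "norm \<xi> = 1" and tangent: "gap \<bullet> \<eta> = 0"
    and close: "(norm (\<xi> - \<eta>))\<^sup>2 \<le> 2 * (gap \<bullet> \<xi>)\<^sup>2 / (gap \<bullet> gap)"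
  shows "Phi p0 * (rate \<xi>' \<eta>' + 2 * c2) \<le> (\<Sum>j\<in>UNIV. \<alpha> $ j * (\<Sum>i\<in>UNIV. \<alpha> $ i * Du i (Du j Phi) p0))"
proof -
  define Q where "Q = gap \<bullet> gap"
  have Q: "Q > 0" unfolding Q_def by (rule gap_sq_pos)
  have "gap \<bullet> (\<xi> - \<eta>) = gap \<bullet> \<xi>" using tangent by (simp add: inner_diff_right)
  then have D: "(\<xi> - \<eta>) \<bullet> (\<xi> - \<eta>) \<le> 2 * (gap \<bullet> (\<xi> - \<eta>))\<^sup>2 / Q"
    using close unfolding Q_def by (simp add: power2_norm_eq_inner)
  have "((\<xi> - \<eta>) \<bullet> (\<xi> - \<eta>)) / Q \<le> 2 * (gap \<bullet> (\<xi> - \<eta>))\<^sup>2 / Q\<^sup>2"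
    using divide_right_mono[OF D, of Q] Q by (simp add: power2_eq_square)
  then have "rate \<xi>' \<eta>' + 2 * c2
      \<le> (rate \<xi> \<eta>)\<^sup>2 + (rate \<xi>' \<eta>' + 2 * c2 * (\<xi> \<bullet> \<xi>) - ((\<xi> - \<eta>) \<bullet> (\<xi> - \<eta>)) / Q
          + 2 * (gap \<bullet> (\<xi> - \<eta>))\<^sup>2 / Q\<^sup>2)"
    using unit by (simp add: norm_eq_sqrt_inner)
  then show ?thesis
    using mult_left_mono[OF _ less_imp_le[OF Phi_pos]] spatial_touching(2)[of \<alpha> \<beta>]
    unfolding \<xi>_def \<eta>_def \<xi>'_def \<eta>'_def Q_def by (meson order_trans)
qed

lemma trace_second_variation_bound:
  "Phi p0 * (rate (\<Sum>i\<in>UNIV. \<Sum>j\<in>UNIV. ginv X p0 $ i $ j *\<^sub>R Du i (Du j X) p0)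
                  (\<Sum>i\<in>UNIV. \<Sum>j\<in>UNIV. ginv Y q0 $ i $ j *\<^sub>R Du i (Du j Y) q0)
             + c2 * (2 * real CARD('n)))
   \<le> (\<Sum>i\<in>UNIV. \<Sum>j\<in>UNIV. ginv X p0 $ i $ j * Du i (Du j Phi) p0)"
proof -
  obtain \<tau> \<sigma> :: "'n \<Rightarrow> real^'N" where \<tau>: "\<And>k. \<tau> k \<bullet> NX p0 = 0"
      "\<And>Z. Z \<bullet> NX p0 = 0 \<Longrightarrow> Z = (\<Sum>k\<in>UNIV. (Z \<bullet> \<tau> k) *\<^sub>R \<tau> k)"
    and \<sigma>: "\<And>k. \<sigma> k \<bullet> NY q0 = 0" "\<And>Z. Z \<bullet> NY q0 = 0 \<Longrightarrow> Z = (\<Sum>k\<in>UNIV. (Z \<bullet> \<sigma> k) *\<^sub>R \<sigma> k)"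
    and paired: "\<And>k. norm (\<tau> k) = 1" "\<And>k. gap \<bullet> \<sigma> k = 0"
      "\<And>k. (norm (\<tau> k - \<sigma> k))\<^sup>2 \<le> 2 * (gap \<bullet> \<tau> k)\<^sup>2 / (gap \<bullet> gap)"
    using frames_along_gap by blast
  define P where "P = (\<lambda>i k. \<Sum>m\<in>UNIV. ginv X p0 $ i $ m * (Du m X p0 \<bullet> \<tau> k))"
  define Q where "Q = (\<lambda>i k. \<Sum>m\<in>UNIV. ginv Y q0 $ i $ m * (Du m Y q0 \<bullet> \<sigma> k))"
  have \<tau>_P: "\<tau> k = (\<Sum>i\<in>UNIV. P i k *\<^sub>R Du i X p0)" and PP: "(\<Sum>k\<in>UNIV. P i k * P j k) = ginv X p0 $ i $ j"
    for i j k
    using orthonormal_frame_coordinates[OF X_frame dim \<tau>] unfolding P_def ginv_def gmat_def by auto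
  have \<sigma>_Q: "\<sigma> k = (\<Sum>i\<in>UNIV. Q i k *\<^sub>R Du i Y q0)" and QQ: "(\<Sum>k\<in>UNIV. Q i k * Q j k) = ginv Y q0 $ i $ j"
    for i j k
    using orthonormal_frame_coordinates[OF Y_frame dim \<sigma>] unfolding Q_def ginv_def gmat_def by auto
  define Xaa where "Xaa = (\<lambda>k. \<Sum>j\<in>UNIV. P j k *\<^sub>R (\<Sum>i\<in>UNIV. P i k *\<^sub>R Du i (Du j X) p0))"
  define Ybb where "Ybb = (\<lambda>k. \<Sum>j\<in>UNIV. Q j k *\<^sub>R (\<Sum>i\<in>UNIV. Q i k *\<^sub>R Du i (Du j Y) q0))"
  have "Phi p0 * (rate (\<Sum>k\<in>UNIV. Xaa k) (\<Sum>k\<in>UNIV. Ybb k) + c2 * (2 * real CARD('n)))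
      = (\<Sum>k\<in>UNIV. Phi p0 * (rate (Xaa k) (Ybb k) + 2 * c2))"
    by (simp add: barrier_rate_sum sum_distrib_left sum.distrib algebra_simps)
  also have "\<dots> \<le> (\<Sum>k\<in>UNIV. \<Sum>j\<in>UNIV. P j k * (\<Sum>i\<in>UNIV. P i k * Du i (Du j Phi) p0))"
  proof (rule sum_mono)
    fix k
    show "Phi p0 * (rate (Xaa k) (Ybb k) + 2 * c2)
        \<le> (\<Sum>j\<in>UNIV. P j k * (\<Sum>i\<in>UNIV. P i k * Du i (Du j Phi) p0))"
      using second_variation_bound[of "\<chi> i. P i k" "\<chi> i. Q i k"] paired[of k]
      unfolding \<tau>_P \<sigma>_Q Xaa_def Ybb_def by simp
  qed
  finally show ?thesis
    using trace_congruence[of P "\<lambda>i j. Du i (Du j Phi) p0"]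
    by (simp add: Xaa_def Ybb_def trace_congruence PP QQ)
qed

lemma laplace_beltrami_lower_bound:
  "Phi p0 * (rate (mean_curv X NX p0 *\<^sub>R NX p0) 0 + mean_curv Y NY q0 * (gap \<bullet> NY q0) / (gap \<bullet> gap)
             + c2 * (2 * real CARD('n)))
   \<le> laplace_beltrami X Phi p0"
proof -
  define coef where "coef = (\<lambda>k. \<Sum>i\<in>UNIV. \<Sum>j\<in>UNIV. ginv X p0 $ i $ j * christoffel X k i j p0)"
  define coefY where "coefY = (\<lambda>k. \<Sum>i\<in>UNIV. \<Sum>j\<in>UNIV. ginv Y q0 $ i $ j * christoffel Y k i j q0)"
  define T where "T = (\<Sum>k\<in>UNIV. coef k *\<^sub>R Du k X p0)"
  have gap_T: "gap \<bullet> (\<Sum>k\<in>UNIV. coefY k *\<^sub>R Du k Y q0) = 0"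
    by (simp add: inner_sum_right tangential_derivatives(2))
  have "rate (\<Sum>i\<in>UNIV. \<Sum>j\<in>UNIV. ginv X p0 $ i $ j *\<^sub>R Du i (Du j X) p0)
             (\<Sum>i\<in>UNIV. \<Sum>j\<in>UNIV. ginv Y q0 $ i $ j *\<^sub>R Du i (Du j Y) q0)
      = rate (T + mean_curv X NX p0 *\<^sub>R NX p0)
             ((\<Sum>k\<in>UNIV. coefY k *\<^sub>R Du k Y q0) + mean_curv Y NY q0 *\<^sub>R NY q0)"
    unfolding trace_hessian_tangent_normal[where N=NX, OF X_frame dim]
      trace_hessian_tangent_normal[where N=NY, OF Y_frame dim]
      T_def coef_def coefY_def ..
  also have "\<dots> = rate T 0 + rate (mean_curv X NX p0 *\<^sub>R NX p0) 0
      + mean_curv Y NY q0 * (gap \<bullet> NY q0) / (gap \<bullet> gap)"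
    by (subst barrier_rate_split)
      (simp add: barrier_rate_add[where \<eta>=0 and \<eta>'=0, simplified] inner_add_right gap_T)
  finally have "Phi p0 * (rate T 0 + rate (mean_curv X NX p0 *\<^sub>R NX p0) 0
      + mean_curv Y NY q0 * (gap \<bullet> NY q0) / (gap \<bullet> gap) + c2 * (2 * real CARD('n)))
    \<le> (\<Sum>i\<in>UNIV. \<Sum>j\<in>UNIV. ginv X p0 $ i $ j * Du i (Du j Phi) p0)"
    using trace_second_variation_bound by simp
  moreover have "rate T 0 = (\<Sum>k\<in>UNIV. coef k * rate (Du k X p0) 0)"
    using barrier_rate_sum[of c2 x0 "X p0" "Y q0" "\<lambda>k. coef k *\<^sub>R Du k X p0" UNIV "\<lambda>k. coef k *\<^sub>R 0"]
    unfolding T_def barrier_rate_scaleR by simp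
  then have "(\<Sum>k\<in>UNIV. coef k * Du k Phi p0) = Phi p0 * rate T 0"
    unfolding tangential_derivatives(1) by (simp add: sum_distrib_left mult_ac)
  ultimately show ?thesis
    unfolding laplace_beltrami_expand coef_def by (simp add: algebra_simps)
qed

lemma heat_op_nonpos: "heat_op X Phi p0 \<le> 0"
proof -
  have "Dt Phi p0 \<le> Phi p0 * (rate (mean_curv X NX p0 *\<^sub>R NX p0) 0
      + mean_curv Y NY q0 * (gap \<bullet> NY q0) / (gap \<bullet> gap) + c2 * (2 * real CARD('n)))"
    using time_touching barrier_rate_split[of c2 x0 "X p0" "Y q0" "Dt X p0" "Dt Y q0"]
    unfolding X_flow Y_flow by simp
  then show ?thesis
    using laplace_beltrami_lower_bound unfolding heat_op_def by simp
qed

end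

lemma mcf_touching_charts:
  fixes A :: "((real^'n::finite) set \<times> (real^'n \<Rightarrow> 'm::topological_space)) set"
    and F N :: "'m \<Rightarrow> real \<Rightarrow> real^'N::finite"
    and B :: "((real^'n) set \<times> (real^'n \<Rightarrow> 'q::topological_space)) set"
    and G NS :: "'q \<Rightarrow> real \<Rightarrow> real^'N"
  assumes dim: "CARD('N) = CARD('n) + 1" and Gamma: "mcf A I F N" and Sigma: "mcf B I G NS"
    and proper: "\<forall>t\<in>I. proper_fun (\<lambda>q. G q t)"
    and disj: "\<forall>t\<in>I. range (\<lambda>p. F p t) \<inter> range (\<lambda>q. G q t) = {}"
    and chart: "(U, \<psi>) \<in> A" "u0 \<in> U" "t0 \<in> I" and W: "open W" "(u0, t0) \<in> W" "W \<subseteq> U \<times> I"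
    and \<phi>: "Ck 2 W (\<lambda>(u,t). \<phi> (\<psi> u) t)"
    and above: "\<And>u t. (u, t) \<in> W \<Longrightarrow> t \<le> t0 \<Longrightarrow>
      exp (c1 + c2 * ((norm (F (\<psi> u) t - x0))\<^sup>2 + 2 * real CARD('n) * t)) / infdist (F (\<psi> u) t) (range (\<lambda>q. G q t))
        \<le> \<phi> (\<psi> u) t"
    and touch: "\<phi> (\<psi> u0) t0 = exp (c1 + c2 * ((norm (F (\<psi> u0) t0 - x0))\<^sup>2 + 2 * real CARD('n) * t0))
      / infdist (F (\<psi> u0) t0) (range (\<lambda>q. G q t0))"
  obtains V \<rho> v0 where "touching_charts (\<lambda>(u,t). F (\<psi> u) t) (\<lambda>(v,t). G (\<rho> v) t) (\<lambda>(u,t). N (\<psi> u) t)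
    (\<lambda>(v,t). NS (\<rho> v) t) (\<lambda>(u,t). \<phi> (\<psi> u) t) W (V \<times> I) u0 v0 t0 c1 c2 x0"
proof -
  obtain V \<rho> v0 where chart\<Sigma>: "(V, \<rho>) \<in> B" "v0 \<in> V"
    and nearest: "infdist (F (\<psi> u0) t0) (range (\<lambda>q. G q t0)) = norm (F (\<psi> u0) t0 - G (\<rho> v0) t0)"
    using mcf_nearest_point_chart[OF Sigma chart(3)] proper chart(3) by metis
  note \<Gamma> = mcf_chartD[OF Gamma chart(1)] and \<Sigma> = mcf_chartD[OF Sigma chart\<Sigma>(1)]
  have below: "F (\<psi> u) t \<noteq> G (\<rho> v) t
      \<and> barrier c1 c2 x0 (2 * real CARD('n)) (F (\<psi> u) t) (G (\<rho> v) t) t \<le> \<phi> (\<psi> u) t"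
    if "(u, t) \<in> W" "(v, t) \<in> V \<times> I" "t \<le> t0" for u v t
  proof -
    have t: "t \<in> I" using that(2) by simp
    have closed: "closed (range (\<lambda>q. G q t))" using mcf_slice_closed[OF Sigma t] proper t by blast
    have x: "F (\<psi> u) t \<notin> range (\<lambda>q. G q t)" using disj t by blast
    have "barrier c1 c2 x0 (2 * real CARD('n)) (F (\<psi> u) t) (G (\<rho> v) t) t \<le> \<phi> (\<psi> u) t"
      using barrier_le_exp_div_infdist[OF rangeI[of "\<lambda>q. G q t" "\<rho> v"] closed x,
          of c1 c2 x0 "2 * real CARD('n)" t]
        above[OF that(1,3)] by (rule order_trans)
    then show ?thesis using x by auto
  qed
  have "touching_charts (\<lambda>(u,t). F (\<psi> u) t) (\<lambda>(v,t). G (\<rho> v) t) (\<lambda>(u,t). N (\<psi> u) t)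
    (\<lambda>(v,t). NS (\<rho> v) t) (\<lambda>(u,t). \<phi> (\<psi> u) t) W (V \<times> I) u0 v0 t0 c1 c2 x0"
  proof
    show "open (V \<times> I)" using \<Sigma>(1,2) by (rule open_Times)
    show "(v0, t0) \<in> V \<times> I" using chart\<Sigma>(2) chart(3) by simp
    show "Ck 2 W (\<lambda>(u,t). F (\<psi> u) t)" using \<Gamma>(3) W(3) unfolding smooth_on_def by (blast intro: Ck_subset)
    show "Ck 2 (V \<times> I) (\<lambda>(v,t). G (\<rho> v) t)" using \<Sigma>(3) unfolding smooth_on_def by blast
    show "(\<lambda>(u,t). \<phi> (\<psi> u) t) (u0, t0) = barrier c1 c2 x0 (2 * real CARD('n))
        ((\<lambda>(u,t). F (\<psi> u) t) (u0, t0)) ((\<lambda>(v,t). G (\<rho> v) t) (v0, t0)) t0"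
      using touch nearest unfolding barrier_def by simp
  qed (use dim W \<phi> \<Gamma>(4)[OF chart(2,3)] \<Sigma>(4)[OF chart\<Sigma>(2) chart(3)] below in simp_all)
  then show ?thesis by (rule that)
qed

theorem lemma19:
  fixes A :: "((real^'n::finite) set \<times> (real^'n \<Rightarrow> 'm::topological_space)) set"
    and F N :: "'m \<Rightarrow> real \<Rightarrow> real^'N::finite"
    and B :: "((real^'n) set \<times> (real^'n \<Rightarrow> 'q::topological_space)) set"
    and G NS :: "'q \<Rightarrow> real \<Rightarrow> real^'N"
    and I :: "real set" and c1 c2 :: real and x0 :: "real^'N"
    and d f :: "real^'N \<Rightarrow> real \<Rightarrow> real"
  assumes dim: "CARD('N) = CARD('n) + 1"
    and Gamma: "mcf A I F N"
    and Sigma: "mcf B I G NS"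
    and proper: "\<forall>t\<in>I. proper_fun (\<lambda>q. G q t)"
    and disj: "\<forall>t\<in>I. range (\<lambda>p. F p t) \<inter> range (\<lambda>q. G q t) = {}"
    and d_def: "d = (\<lambda>x t. infdist x (range (\<lambda>q. G q t)))"
    and f_def: "f = (\<lambda>x t. c1 + c2 * ((norm (x - x0))\<^sup>2 + 2 * real CARD('n) * t))"
  shows "\<forall>(U,\<psi>)\<in>A. \<forall>u0\<in>U. \<forall>t0\<in>I. \<forall>(\<phi>::'m \<Rightarrow> real \<Rightarrow> real) W.
           open W \<and> (u0, t0) \<in> W \<and> W \<subseteq> U \<times> I \<and>
           Ck 2 W (\<lambda>(u,t). \<phi> (\<psi> u) t) \<and>
           (\<forall>(u,t)\<in>W. t \<le> t0 \<longrightarrow>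
               \<phi> (\<psi> u) t \<ge> exp (f (F (\<psi> u) t) t) / d (F (\<psi> u) t) t) \<and>
           \<phi> (\<psi> u0) t0 = exp (f (F (\<psi> u0) t0) t0) / d (F (\<psi> u0) t0) t0
           \<longrightarrow> heat_op (\<lambda>(u,t). F (\<psi> u) t) (\<lambda>(u,t). \<phi> (\<psi> u) t) (u0, t0) \<le> 0"
proof -
  have "heat_op (\<lambda>(u,t). F (\<psi> u) t) (\<lambda>(u,t). \<phi> (\<psi> u) t) (u0, t0) \<le> 0"
    if chart: "(U, \<psi>) \<in> A" "u0 \<in> U" "t0 \<in> I" and W: "open W" "(u0, t0) \<in> W" "W \<subseteq> U \<times> I"
      and \<phi>: "Ck 2 W (\<lambda>(u,t). \<phi> (\<psi> u) t)"
      and above: "\<forall>(u,t)\<in>W. t \<le> t0 \<longrightarrow> \<phi> (\<psi> u) t \<ge> exp (f (F (\<psi> u) t) t) / d (F (\<psi> u) t) t"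
      and touch: "\<phi> (\<psi> u0) t0 = exp (f (F (\<psi> u0) t0) t0) / d (F (\<psi> u0) t0) t0"
    for U \<psi> u0 t0 \<phi> W
  proof -
    have "exp (f (F (\<psi> u) t) t) / d (F (\<psi> u) t) t \<le> \<phi> (\<psi> u) t" if "(u, t) \<in> W" "t \<le> t0" for u t
      using above that by auto
    then obtain V \<rho> v0 where "touching_charts (\<lambda>(u,t). F (\<psi> u) t) (\<lambda>(v,t). G (\<rho> v) t)
      (\<lambda>(u,t). N (\<psi> u) t) (\<lambda>(v,t). NS (\<rho> v) t) (\<lambda>(u,t). \<phi> (\<psi> u) t) W (V \<times> I) u0 v0 t0 c1 c2 x0"
      using mcf_touching_charts[OF dim Gamma Sigma proper disj chart W \<phi>] touch
      unfolding d_def f_def by blast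
    then show ?thesis by (rule touching_charts.heat_op_nonpos)
  qed
  then show ?thesis by blast
qed

end
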